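(* Let $p$ be a prime number, let $(G,\theta)$ be a $p$-oriented profinite group satisfying formal Hilbert 90, and let $\chi_1,\chi_2,\chi_3\in H^1(G,\mathbb Z/p\mathbb Z)$. The following are equivalent: (1) $\chi_1\cup\chi_2=\chi_2\cup\chi_3=0$ in $H^2(G,\mathbb Z/p\mathbb Z)$; (2) the mod $p$ Massey product $\langle\chi_1,\chi_2,\chi_3\rangle$ is defined; (3) the mod $p$ Massey product $\langle\chi_1,\chi_2,\chi_3\rangle$ vanishes.
   Context: A $p$-oriented profinite group is a pair $(G,\theta)$ with $G$ a profinite group and $\theta\colon G\to\mathbb Z_p^\times$ a continuous homomorphism. For $n\geq 1$, $\mathbb Z/p^n\mathbb Z(1)$ denotes the discrete $G$-module $\mathbb Z/p^n\mathbb Z$ with $g\cdot v=\theta(g)v$. $(G,\theta)$ satisfies formal Hilbert 90 if for every open subgroup $H\subset G$ and every $n\geq1$ the reduction map $H^1(H,\mathbb Z/p^n\mathbb Z(1))\to H^1(H,\mathbb Z/p\mathbb Z(1))$ is surjective. Here $\mathbb Z/p\mathbb Z$ (without twist) has trivial $G$-action. Massey products: For a differential graded ring $(A,\partial)$ and $a_1,\dots,a_n\in H^1(A)$ ($n\ge2$), a defining system for $\langle a_1,\dots,a_n\rangle$ is a collection of elements $a_{ij}\in A^1$, $1\le i<j\le n+1$, $(i,j)\ne(1,n+1)$, with $\partial a_{i,i+1}=0$, $a_{i,i+1}$ representing $a_i$, and $\partial(a_{ij})=-\sum_{l=i+1}^{j-1}a_{il}a_{lj}$ for $i<j-1$; its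 value is the class of the 2-cocycle $-\sum_{l=2}^n a_{1l}a_{l,n+1}$ in $H^2(A)$. The Massey product $\langle a_1,\dots,a_n\rangle\subset H^2(A)$ is the set of all values of defining systems; it is defined if nonempty and vanishes if it contains $0$. Mod $p$ Massey products for $G$ are taken in the differential graded ring of continuous inhomogeneous cochains $C^*(G,\mathbb Z/p\mathbb Z)$ with cup product. *)

theory Defs
  imports "HOL-Analysis.Analysis" "HOL-Algebra.Group"
begin

definition totally_disconnected_space :: "'a topology \<Rightarrow> bool" where
  "totally_disconnected_space T \<longleftrightarrow>
     (\<forall>S. connectedin T S \<longrightarrow> (\<exists>a. S \<subseteq> {a}))"

definition profinite_group :: "('a, 'b) monoid_scheme \<Rightarrow> 'a topology \<Rightarrow> bool" where
  "profinite_group G T \<longleftrightarrow>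
     group G \<and> topspace T = carrier G \<and>
     compact_space T \<and> Hausdorff_space T \<and> totally_disconnected_space T \<and>
     continuous_map (prod_topology T T) T (\<lambda>(x, y). x \<otimes>\<^bsub>G\<^esub> y) \<and>
     continuous_map T T (\<lambda>x. inv\<^bsub>G\<^esub> x)"

abbreviation disc :: "int topology" where
  "disc \<equiv> discrete_topology UNIV"

text \<open>$\mathbb Z_p = \varprojlim \mathbb Z/p^n$ with the inverse limit topology.
  A continuous homomorphism $\theta: G \to \mathbb Z_p^\times$ is encoded by its
  reductions: theta g n is the residue of $\theta(g)$ modulo $p^n$ (for $n \ge 1$),
  represented in $\{0,\dots,p^n-1\}$. Continuity into the inverse limit topology
  is continuity of every reduction into the discrete group $\mathbb Z/p^n$.\<close>
definition p_orientation ::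
  "nat \<Rightarrow> ('a, 'b) monoid_scheme \<Rightarrow> 'a topology \<Rightarrow> ('a \<Rightarrow> nat \<Rightarrow> int) \<Rightarrow> bool" where
  "p_orientation p G T \<theta> \<longleftrightarrow>
     (\<forall>n\<ge>1. \<forall>g\<in>carrier G.
        \<theta> g n \<in> {0..<int p ^ n} \<and> coprime (\<theta> g n) (int p) \<and>
        \<theta> g (Suc n) mod (int p ^ n) = \<theta> g n) \<and>
     (\<forall>n\<ge>1. \<forall>g\<in>carrier G. \<forall>h\<in>carrier G.
        \<theta> (g \<otimes>\<^bsub>G\<^esub> h) n = (\<theta> g n * \<theta> h n) mod (int p ^ n)) \<and>
     (\<forall>n\<ge>1. continuous_map T disc (\<lambda>g. \<theta> g n))"

definition cochain1_on :: "'a topology \<Rightarrow> 'a set \<Rightarrow> int \<Rightarrow> ('a \<Rightarrow> int) \<Rightarrow> bool" where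
  "cochain1_on T H m f \<longleftrightarrow>
     continuous_map (subtopology T H) disc f \<and> (\<forall>x\<in>H. f x \<in> {0..<m})"

definition twisted_cocycle1 ::
  "nat \<Rightarrow> ('a, 'b) monoid_scheme \<Rightarrow> 'a topology \<Rightarrow> ('a \<Rightarrow> nat \<Rightarrow> int) \<Rightarrow> 'a set \<Rightarrow> nat
     \<Rightarrow> ('a \<Rightarrow> int) \<Rightarrow> bool" where
  "twisted_cocycle1 p G T \<theta> H n f \<longleftrightarrow>
     cochain1_on T H (int p ^ n) f \<and>
     (\<forall>g\<in>H. \<forall>h\<in>H. f (g \<otimes>\<^bsub>G\<^esub> h) = (f g + \<theta> g n * f h) mod (int p ^ n))"

text \<open>Formal Hilbert 90: for every open subgroup H and every n \<ge> 1 the reduction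
  $H^1(H,\mathbb Z/p^n(1)) \to H^1(H,\mathbb Z/p(1))$ is surjective: every
  continuous 1-cocycle f mod p is cohomologous (differs by the coboundary
  $h \mapsto h\cdot c - c$ of a 0-cochain c) to the reduction mod p of a continuous
  1-cocycle mod $p^n$.\<close>
definition formal_hilbert90 ::
  "nat \<Rightarrow> ('a, 'b) monoid_scheme \<Rightarrow> 'a topology \<Rightarrow> ('a \<Rightarrow> nat \<Rightarrow> int) \<Rightarrow> bool" where
  "formal_hilbert90 p G T \<theta> \<longleftrightarrow>
     (\<forall>H n. subgroup H G \<and> openin T H \<and> n \<ge> 1 \<longrightarrow>
        (\<forall>f. twisted_cocycle1 p G T \<theta> H 1 f \<longrightarrow>
           (\<exists>F c. twisted_cocycle1 p G T \<theta> H n F \<and> c \<in> {0..<int p} \<and>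
              (\<forall>h\<in>H. f h = (F h mod int p + (\<theta> h 1 * c - c)) mod int p))))"

definition cochain1 :: "nat \<Rightarrow> ('a, 'b) monoid_scheme \<Rightarrow> 'a topology \<Rightarrow> ('a \<Rightarrow> int) \<Rightarrow> bool" where
  "cochain1 p G T a \<longleftrightarrow> cochain1_on T (carrier G) (int p) a"

definition cochain2 ::
  "nat \<Rightarrow> ('a, 'b) monoid_scheme \<Rightarrow> 'a topology \<Rightarrow> ('a \<Rightarrow> 'a \<Rightarrow> int) \<Rightarrow> bool" where
  "cochain2 p G T c \<longleftrightarrow>
     continuous_map (prod_topology T T) disc (\<lambda>(x, y). c x y) \<and>
     (\<forall>x\<in>carrier G. \<forall>y\<in>carrier G. c x y \<in> {0..<int p})"

definition d1 :: "nat \<Rightarrow> ('a, 'b) monoid_scheme \<Rightarrow> ('a \<Rightarrow> int) \<Rightarrow> 'a \<Rightarrow> 'a \<Rightarrow> int" where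
  "d1 p G a g h = (a h - a (g \<otimes>\<^bsub>G\<^esub> h) + a g) mod int p"

definition cup11 :: "nat \<Rightarrow> ('a \<Rightarrow> int) \<Rightarrow> ('a \<Rightarrow> int) \<Rightarrow> 'a \<Rightarrow> 'a \<Rightarrow> int" where
  "cup11 p a b g h = (a g * b h) mod int p"

text \<open>A continuous 1-cocycle mod p. With trivial action $B^1 = 0$, so these are
  exactly the elements of $H^1(G,\mathbb Z/p)$.\<close>
definition cocycle1 :: "nat \<Rightarrow> ('a, 'b) monoid_scheme \<Rightarrow> 'a topology \<Rightarrow> ('a \<Rightarrow> int) \<Rightarrow> bool" where
  "cocycle1 p G T a \<longleftrightarrow> cochain1 p G T a \<and>
     (\<forall>g\<in>carrier G. \<forall>h\<in>carrier G. d1 p G a g h = 0)"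

definition h2_zero ::
  "nat \<Rightarrow> ('a, 'b) monoid_scheme \<Rightarrow> 'a topology \<Rightarrow> ('a \<Rightarrow> 'a \<Rightarrow> int) \<Rightarrow> bool" where
  "h2_zero p G T c \<longleftrightarrow>
     (\<exists>b. cochain1 p G T b \<and> (\<forall>g\<in>carrier G. \<forall>h\<in>carrier G. c g h = d1 p G b g h))"

text \<open>Defining system $(a_{12},a_{23},a_{34},a_{13},a_{24})$ for
  $\langle\chi_1,\chi_2,\chi_3\rangle$. Since $B^1(G,\mathbb Z/p) = 0$, "$a_{i,i+1}$
  represents $\chi_i$" means $a_{i,i+1} = \chi_i$.\<close>
definition massey3_defining_system ::
  "nat \<Rightarrow> ('a, 'b) monoid_scheme \<Rightarrow> 'a topology \<Rightarrow>
   ('a \<Rightarrow> int) \<Rightarrow> ('a \<Rightarrow> int) \<Rightarrow> ('a \<Rightarrow> int) \<Rightarrow>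
   ('a \<Rightarrow> int) \<Rightarrow> ('a \<Rightarrow> int) \<Rightarrow> ('a \<Rightarrow> int) \<Rightarrow> ('a \<Rightarrow> int) \<Rightarrow> ('a \<Rightarrow> int) \<Rightarrow> bool" where
  "massey3_defining_system p G T x1 x2 x3 a12 a23 a34 a13 a24 \<longleftrightarrow>
     cochain1 p G T a12 \<and> cochain1 p G T a23 \<and> cochain1 p G T a34 \<and>
     cochain1 p G T a13 \<and> cochain1 p G T a24 \<and>
     (\<forall>g\<in>carrier G. \<forall>h\<in>carrier G.
        d1 p G a12 g h = 0 \<and> d1 p G a23 g h = 0 \<and> d1 p G a34 g h = 0) \<and>
     (\<forall>g\<in>carrier G. a12 g = x1 g \<and> a23 g = x2 g \<and> a34 g = x3 g) \<and>
     (\<forall>g\<in>carrier G. \<forall>h\<in>carrier G.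
        d1 p G a13 g h = (- cup11 p a12 a23 g h) mod int p \<and>
        d1 p G a24 g h = (- cup11 p a23 a34 g h) mod int p)"

definition massey3_value ::
  "nat \<Rightarrow> ('a \<Rightarrow> int) \<Rightarrow> ('a \<Rightarrow> int) \<Rightarrow> ('a \<Rightarrow> int) \<Rightarrow> ('a \<Rightarrow> int) \<Rightarrow> 'a \<Rightarrow> 'a \<Rightarrow> int" where
  "massey3_value p a12 a34 a13 a24 g h =
     (- (cup11 p a12 a24 g h + cup11 p a13 a34 g h)) mod int p"

definition massey3_defined ::
  "nat \<Rightarrow> ('a, 'b) monoid_scheme \<Rightarrow> 'a topology \<Rightarrow>
   ('a \<Rightarrow> int) \<Rightarrow> ('a \<Rightarrow> int) \<Rightarrow> ('a \<Rightarrow> int) \<Rightarrow> bool" where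
  "massey3_defined p G T x1 x2 x3 \<longleftrightarrow>
     (\<exists>a12 a23 a34 a13 a24. massey3_defining_system p G T x1 x2 x3 a12 a23 a34 a13 a24)"

definition massey3_vanishes ::
  "nat \<Rightarrow> ('a, 'b) monoid_scheme \<Rightarrow> 'a topology \<Rightarrow>
   ('a \<Rightarrow> int) \<Rightarrow> ('a \<Rightarrow> int) \<Rightarrow> ('a \<Rightarrow> int) \<Rightarrow> bool" where
  "massey3_vanishes p G T x1 x2 x3 \<longleftrightarrow>
     (\<exists>a12 a23 a34 a13 a24. massey3_defining_system p G T x1 x2 x3 a12 a23 a34 a13 a24 \<and>
        h2_zero p G T (massey3_value p a12 a34 a13 a24))"

end

theory Submission
  imports Defs "HOL-Number_Theory.Residues"
begin

text \<open>Replacing \<open>\<theta>\<close> by its quotient by the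
  Teichmueller lift of \<open>\<theta> mod p\<close> we may assume that \<open>\<theta>\<close> is trivial modulo \<open>p\<close>; by transfer from
  the kernel of \<open>\<theta> mod p\<close>, whose index is prime to \<open>p\<close>, every homomorphism from an open subgroup to
  \<open>\<int>/p\<close> still lifts to a cocycle in \<open>\<int>/p\<^sup>2\<close>.

  A cochain \<open>c\<close> with coboundary \<open>\<chi>\<^sub>2 \<union> X\<close> gives the cocycle \<open>g \<mapsto> (u \<mapsto> c g - u \<chi>\<^sub>2 g)\<close> with values in the
  functions on \<open>\<int>/p\<close>, on which \<open>G\<close> acts by translation through \<open>X\<close>. By Shapiro's lemma it lifts to
  a cocycle \<open>k\<close> modulo \<open>p\<^sup>2\<close>. Take such lifts \<open>k\<^sub>1, k\<^sub>3, k\<^sub>l\<close> for \<open>X = \<chi>\<^sub>1, \<chi>\<^sub>3, \<chi>\<^sub>1 - \<chi>\<^sub>3\<close>, and consider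
  the combination \<open>A g = \<Sum>u. u (k\<^sub>l g (u + 1) - k\<^sub>1 g u - k\<^sub>3 g u)\<close> over \<open>0 \<le> u < p\<close>. Up to cochains whose
  coboundary is understood, its coboundary is \<open>p\<close> times a value of the Massey product: the Massey
  product appears through the quadratic terms produced by shifting \<open>u\<close>. Since \<open>A mod p\<close> is a
  homomorphism it lifts to a cocycle \<open>F\<close> modulo \<open>p\<^sup>2\<close>, and \<open>(A - F) / p\<close> shows that this value is zero.\<close>

section \<open>Locally constant functions\<close>

text \<open>Continuity on \<open>N\<close> into the discrete integers, phrased by open fibres so
  that cochains on \<open>G\<close> and on its open subgroups are treated alike. Values stay
  unreduced integers because they are read both modulo \<open>p\<close> and modulo
  \<open>p ^ 2\<close>.\<close>

definition locally_constant_on :: "'a topology \<Rightarrow> 'a set \<Rightarrow> ('a \<Rightarrow> int) \<Rightarrow> bool" where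
  "locally_constant_on T N f \<longleftrightarrow> (\<forall>y. openin T {x \<in> N. f x = y})"

lemma continuous_map_disc_iff:
  "continuous_map X disc f \<longleftrightarrow> (\<forall>y. openin X {x \<in> topspace X. f x = y})"
proof
  assume "continuous_map X disc f"
  then show "\<forall>y. openin X {x \<in> topspace X. f x = y}"
    using openin_continuous_map_preimage[of X disc f "{y}" for y] by fastforce
next
  assume *: "\<forall>y. openin X {x \<in> topspace X. f x = y}"
  have "openin X {x \<in> topspace X. f x \<in> U}" for U
  proof -
    have "{x \<in> topspace X. f x \<in> U} = (\<Union>y\<in>U. {x \<in> topspace X. f x = y})"
      by auto
    then show ?thesis
      using * by (metis (no_types, lifting) imageE openin_Union)
  qed
  then show "continuous_map X disc f"
    by (simp add: continuous_map)
qed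

lemma continuous_map_subtopology_disc_iff:
  assumes "openin T N"
  shows "continuous_map (subtopology T N) disc f \<longleftrightarrow> locally_constant_on T N f"
proof -
  have "topspace (subtopology T N) = N"
    using assms openin_subset by (metis topspace_subtopology_subset)
  moreover have "{x \<in> N. f x = y} \<subseteq> N" for y
    by auto
  ultimately show ?thesis
    unfolding continuous_map_disc_iff locally_constant_on_def
    using assms by (simp add: openin_open_subtopology)
qed

text \<open>For functions whose formula depends on a coset, recorded by \<open>q x\<close>: each
  fibre is a union of open pieces on which the formula is fixed.\<close>

lemma locally_constant_on_pieces:
  assumes "\<And>w y. openin T {x \<in> N. q x = w \<and> f w x = y}"
  shows "locally_constant_on T N (\<lambda>x. f (q x) x)"
  unfolding locally_constant_on_def
proof
  fix y
  have "{x \<in> N. f (q x) x = y} = (\<Union>w. {x \<in> N. q x = w \<and> f w x = y})"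
    by auto
  then show "openin T {x \<in> N. f (q x) x = y}"
    using assms by auto
qed

lemma locally_constant_on_compose2:
  assumes "locally_constant_on T N f" "locally_constant_on T N g"
  shows "locally_constant_on T N (\<lambda>x. F (f x) (g x))"
proof (rule locally_constant_on_pieces[where q = f and f = "\<lambda>w x. F w (g x)"])
  fix w y
  have "{x \<in> N. f x = w \<and> F w (g x) = y} =
      (\<Union>z\<in>{z. F w z = y}. {x \<in> N. f x = w} \<inter> {x \<in> N. g x = z})"
    by auto
  moreover have "openin T ({x \<in> N. f x = w} \<inter> {x \<in> N. g x = z})" for z
    using assms unfolding locally_constant_on_def by blast
  ultimately show "openin T {x \<in> N. f x = w \<and> F w (g x) = y}"
    by (metis (no_types, lifting) imageE openin_Union)
qed

lemma locally_constant_on_compose: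
  assumes "locally_constant_on T N f"
  shows "locally_constant_on T N (\<lambda>x. F (f x))"
  using locally_constant_on_compose2[OF assms assms, of "\<lambda>x y. F x"] .

lemma locally_constant_on_const:
  assumes "openin T N"
  shows "locally_constant_on T N (\<lambda>x. c)"
proof -
  have "{x \<in> N. c = y} = (if c = y then N else {})" for y
    by auto
  then show ?thesis
    using assms unfolding locally_constant_on_def by simp
qed

lemma locally_constant_on_sum:
  assumes "openin T N" "finite I" "\<And>i. i \<in> I \<Longrightarrow> locally_constant_on T N (f i)"
  shows "locally_constant_on T N (\<lambda>x. \<Sum>i\<in>I. f i x)"
  using assms(2,3)
proof (induction I rule: finite_induct)
  case empty
  then show ?case
    using locally_constant_on_const[OF assms(1)] by simp
next
  case (insert i I)
  then show ?case
    using locally_constant_on_compose2[of T N "f i" "\<lambda>x. \<Sum>i\<in>I. f i x" "(+)"] by simp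
qed

lemma locally_constant_on_subset:
  assumes "locally_constant_on T N f" "openin T M" "M \<subseteq> N"
  shows "locally_constant_on T M f"
proof -
  have "{x \<in> M. f x = y} = M \<inter> {x \<in> N. f x = y}" for y
    using assms(3) by auto
  then show ?thesis
    using assms unfolding locally_constant_on_def by (simp add: openin_Int)
qed

section \<open>Periodic functions modulo \<open>p\<^sup>2\<close>\<close>

text \<open>The multiples of \<open>m\<close> modulo \<open>m ^ 2\<close> form a copy of the
  residues modulo \<open>m\<close>. In this way relations between cochains modulo \<open>p\<close>
  are extracted from relations modulo \<open>p ^ 2\<close>.\<close>

lemma cong_mult_modulus_cancel:
  fixes m :: int
  assumes "[m * a = m * b] (mod m ^ 2)" "m > 0"
  shows "[a = b] (mod m)"
  using assms by (simp add: cong_iff_dvd_diff power2_eq_square flip: right_diff_distrib)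

text \<open>First moment of a translate of \<open>k\<close>, weighted by the representatives 0 to
  \<open>p - 1\<close>. The weight is not periodic, so translation changes the moment; this defect
  is the source of the products in the Massey value.\<close>

definition moment :: "nat \<Rightarrow> (int \<Rightarrow> int) \<Rightarrow> int \<Rightarrow> int" where
  "moment p k x = (\<Sum>i<p. int i * k (int i + x))"

lemma sum_lessThan_shift:
  fixes h :: "nat \<Rightarrow> int"
  shows "(\<Sum>i<n. h (Suc i)) = (\<Sum>i<n. h i) + h n - h 0"
  using sum.lessThan_Suc_shift[of h n] sum.lessThan_Suc[of h n] by simp

lemma periodic_add:
  fixes k :: "int \<Rightarrow> int"
  assumes "\<And>u. k (u mod int p) = k u"
  shows "k (int p + x) = k x"
  using assms[of "int p + x"] assms[of x] by simp

lemma periodic_sum_shift: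
  fixes k :: "int \<Rightarrow> int"
  assumes "\<And>u. k (u mod int p) = k u"
  shows "(\<Sum>i<p. k (int i + x)) = (\<Sum>i<p. k (int i))"
proof -
  have step: "(\<Sum>i<p. k (int i + (x + 1))) = (\<Sum>i<p. k (int i + x))" for x
    using sum_lessThan_shift[of "\<lambda>i. k (int i + x)" p] periodic_add[of k p x] assms
    by (simp add: algebra_simps)
  show ?thesis
  proof (induction x rule: int_induct[where k = 0])
    case (step2 i)
    then show ?case
      using step[of "i - 1"] by simp
  qed (simp_all only: step add_0_right)
qed

text \<open>Shift the summation index: the weight \<open>Suc i\<close> splits into \<open>i\<close>
  and 1, and the boundary term at \<open>i = p\<close> folds back to \<open>k x\<close> by
  periodicity, with weight \<open>p\<close>.\<close>

lemma moment_step: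
  assumes "\<And>u. k (u mod int p) = k u"
  shows "moment p k (x + 1) = moment p k x + int p * k x - (\<Sum>i<p. k (int i))"
proof -
  have "(\<Sum>i<p. int (Suc i) * k (int (Suc i) + x)) =
      moment p k (x + 1) + (\<Sum>i<p. k (int i + (x + 1)))"
    by (simp add: moment_def sum.distrib algebra_simps)
  moreover have "(\<Sum>i<p. int (Suc i) * k (int (Suc i) + x)) = moment p k x + int p * k x"
    using sum_lessThan_shift[of "\<lambda>i. int i * k (int i + x)" p] periodic_add[of k p x] assms
    by (simp add: moment_def)
  ultimately show ?thesis
    using periodic_sum_shift[where k = k, OF assms, of "x + 1"] by simp
qed

text \<open>Iterate the unit step, upwards or downwards from 0. Each step brings in
  \<open>int p * k\<close>, for which \<open>k\<close> modulo \<open>p\<close> suffices, and adding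
  up \<open>c - i * d\<close> produces the binomial coefficient in front of
  \<open>d\<close>.\<close>

lemma moment_cong:
  assumes per: "\<And>u. k (u mod int p) = k u"
    and k: "\<And>u. [k u = c - u * d] (mod int p)"
  shows "[moment p k x = moment p k 0 + int p * (x * c - (x * (x - 1) div 2) * d)
      - x * (\<Sum>i<p. k (int i))] (mod int p ^ 2)"
proof -
  define D where "D = (\<lambda>x. moment p k x - (moment p k 0 + int p * (x * c - (x * (x - 1) div 2) * d)
      - x * (\<Sum>i<p. k (int i))))"
  have D_step: "[D (x + 1) = D x] (mod int p ^ 2)" for x
  proof -
    have "(x + 1) * (x + 1 - 1) = x * (x - 1) + x * 2"
      by (simp add: algebra_simps)
    then have half: "((x + 1) * (x + 1 - 1)) div 2 = x * (x - 1) div 2 + x"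
      by (simp only:)
    have "D (x + 1) - D x = int p * (k x - (c - x * d))"
      unfolding D_def half moment_step[where k = k, OF per] by (simp add: algebra_simps)
    moreover have "int p * int p dvd int p * (k x - (c - x * d))"
      using k[of x] by (intro mult_dvd_mono) (simp_all add: cong_iff_dvd_diff)
    ultimately show ?thesis
      by (simp add: cong_iff_dvd_diff power2_eq_square)
  qed
  have "[D x = 0] (mod int p ^ 2)"
  proof (induction x rule: int_induct[where k = 0])
    case base
    then show ?case
      by (simp add: D_def)
  next
    case (step1 i)
    then show ?case
      using D_step[of i] by (simp add: cong_def)
  next
    case (step2 i)
    then show ?case
      using D_step[of "i - 1"] by (simp add: cong_def)
  qed
  then show ?thesis
    unfolding D_def by (simp add: cong_iff_dvd_diff)
qed

text \<open>The constant \<open>c\<close> is added \<open>p\<close> times and drops out. The sum of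
  the indices is kept as it stands because it is 1 when \<open>p = 2\<close>.\<close>

lemma sum_affine_cong:
  assumes "\<And>u. [k u = c - u * d] (mod int p)"
  shows "[(\<Sum>i<p. k (int i)) = - (d * (\<Sum>i<p. int i))] (mod int p)"
proof -
  have "[(\<Sum>i<p. k (int i)) = (\<Sum>i<p. c - int i * d)] (mod int p)"
    using assms by (intro cong_sum)
  also have "(\<Sum>i<p. c - int i * d) = - (d * (\<Sum>i<p. int i)) + int p * c"
    by (simp add: sum_subtractf sum_distrib_left mult.commute)
  also have "[- (d * (\<Sum>i<p. int i)) + int p * c = - (d * (\<Sum>i<p. int i))] (mod int p)"
    by (simp add: cong_iff_dvd_diff)
  finally show ?thesis .
qed

lemma double_sum_int: "2 * (\<Sum>i<n. int i) = int n * (int n - 1)"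
  by (induction n) (simp_all add: algebra_simps)

section \<open>Lifting cocycles modulo \<open>p\<^sup>2\<close>\<close>

locale oriented_group = group G for G :: "('a, 'b) monoid_scheme" (structure) +
  fixes p :: nat and T :: "'a topology" and \<theta> :: "'a \<Rightarrow> nat \<Rightarrow> int"
  assumes prime_p: "prime p"
    and profinite: "profinite_group G T"
    and orientation: "p_orientation p G T \<theta>"
    and hilbert90: "formal_hilbert90 p G T \<theta>"
begin

abbreviation lc :: "'a set \<Rightarrow> ('a \<Rightarrow> int) \<Rightarrow> bool" where
  "lc \<equiv> locally_constant_on T"

lemma topspace_T: "topspace T = carrier G"
  using profinite by (simp add: profinite_group_def)

lemma openin_carrier: "openin T (carrier G)"
  using openin_topspace[of T] by (simp add: topspace_T)

lemma p_pos: "int p > 0"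
  using prime_p prime_gt_0_nat by simp

lemma lc_carrier_iff: "lc (carrier G) f \<longleftrightarrow> continuous_map T disc f"
  using continuous_map_subtopology_disc_iff[OF openin_carrier]
  by (metis subtopology_topspace topspace_T)

lemma openin_translate:
  assumes "lc N f" "openin T N" "s \<in> carrier G" "t \<in> carrier G"
  shows "openin T {g \<in> carrier G. s \<otimes> g \<otimes> t \<in> N \<and> f (s \<otimes> g \<otimes> t) = y}"
proof -
  have mult: "continuous_map (prod_topology T T) T (\<lambda>(x, y). x \<otimes> y)"
    using profinite by (simp add: profinite_group_def)
  have comp: "continuous_map T T (\<lambda>g. u g \<otimes> v g)"
    if "continuous_map T T u" "continuous_map T T v" for u v
    using continuous_map_compose[OF continuous_map_pairedI[OF that] mult] by (simp add: o_def)
  have "continuous_map T T (\<lambda>g. s \<otimes> g \<otimes> t)"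
    using assms by (intro comp) (auto simp: topspace_T)
  then have "openin T {g \<in> topspace T. s \<otimes> g \<otimes> t \<in> {x \<in> N. f x = y}}"
    using assms(1) openin_continuous_map_preimage unfolding locally_constant_on_def by blast
  then show ?thesis
    by (simp add: topspace_T)
qed

section \<open>The orientation and its twist modulo \<open>p ^ 2\<close>\<close>

lemma theta_props:
  assumes "n \<ge> 1" "g \<in> carrier G"
  shows "\<theta> g n \<in> {0..<int p ^ n}" "coprime (\<theta> g n) (int p)"
    "\<theta> g (Suc n) mod int p ^ n = \<theta> g n"
  using orientation assms unfolding p_orientation_def by blast+

lemma theta_mult:
  assumes "n \<ge> 1" "g \<in> carrier G" "h \<in> carrier G"
  shows "\<theta> (g \<otimes> h) n = (\<theta> g n * \<theta> h n) mod (int p ^ n)"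
  using orientation assms unfolding p_orientation_def by blast

lemma lc_theta: "n \<ge> 1 \<Longrightarrow> lc (carrier G) (\<lambda>g. \<theta> g n)"
  using orientation unfolding p_orientation_def by (simp add: lc_carrier_iff)

lemma theta_1_2: "g \<in> carrier G \<Longrightarrow> \<theta> g 2 mod int p = \<theta> g 1"
  using theta_props(3)[of 1 g] by (simp add: numeral_2_eq_2)

text \<open>Modulo \<open>p\<^sup>2\<close> the Teichmueller lift of \<open>\<theta> mod p\<close> is \<open>\<theta>\<^sup>p\<close>, whose inverse is \<open>\<theta> ^ (p * (p - 2))\<close>,
  and \<open>1 + p * (p - 2) = (p - 1)\<^sup>2\<close>.\<close>

definition tw :: "'a \<Rightarrow> int" where
  "tw g = \<theta> g 2 ^ ((p - 1) ^ 2)"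

lemma lc_tw: "lc (carrier G) tw"
  using locally_constant_on_compose[OF lc_theta[of 2], of "\<lambda>x. x ^ ((p - 1) ^ 2)"]
  unfolding tw_def by simp

lemma tw_mult:
  assumes "g \<in> carrier G" "h \<in> carrier G"
  shows "[tw (g \<otimes> h) = tw g * tw h] (mod int p ^ 2)"
proof -
  have "[\<theta> (g \<otimes> h) 2 = \<theta> g 2 * \<theta> h 2] (mod int p ^ 2)"
    using theta_mult[of 2 g h] assms by (simp add: cong_def)
  then show ?thesis
    using cong_pow unfolding tw_def by (metis power_mult_distrib)
qed

text \<open>Fermat's little theorem applies, as the exponent is a multiple of \<open>p - 1\<close>
  and \<open>\<theta> g 2\<close> is prime to \<open>p\<close>.\<close>

lemma tw_cong_1:
  assumes "g \<in> carrier G"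
  shows "[tw g = 1] (mod int p)"
proof -
  have "coprime (\<theta> g 2) (int p)" and ge: "\<theta> g 2 \<ge> 0"
    using theta_props[of 2 g] assms by auto
  then have "\<not> int p dvd \<theta> g 2"
    using prime_p by (metis coprime_absorb_right coprime_commute not_prime_unit prime_int_nat_transfer of_nat_0_le_iff nat_int)
  then have "\<not> p dvd nat (\<theta> g 2)"
    using ge by (metis int_nat_eq int_dvd_int_iff)
  then have "[nat (\<theta> g 2) ^ (p - 1) = 1] (mod p)"
    using fermat_theorem prime_p by blast
  then have "[\<theta> g 2 ^ (p - 1) = 1] (mod int p)"
    using ge by (metis cong_int_iff int_nat_eq of_nat_1 of_nat_power)
  then show ?thesis
    using cong_pow unfolding tw_def by (metis power2_eq_square power_mult power_one)
qed

text \<open>Powers of \<open>1 + int p * y\<close> modulo \<open>p ^ 2\<close> depend only on the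
  exponent modulo \<open>p\<close>, and \<open>(p - 1) ^ 2\<close> is 1 modulo
  \<open>p\<close>.\<close>

lemma power_cong_square_of_cong_1:
  assumes "[x = 1] (mod int p)"
  shows "[x ^ ((p - 1) ^ 2) = x] (mod int p ^ 2)"
proof -
  have bern: "[(1 + int p * y) ^ n = 1 + int n * int p * y] (mod int p ^ 2)" for y n
  proof (induction n)
    case (Suc n)
    have "[(1 + int p * y) ^ Suc n = (1 + int p * y) * (1 + int n * int p * y)] (mod int p ^ 2)"
      using Suc cong_scalar_left by fastforce
    also have "(1 + int p * y) * (1 + int n * int p * y) =
        1 + int (Suc n) * int p * y + int p ^ 2 * (int n * y ^ 2)"
      by (simp add: algebra_simps power2_eq_square)
    also have "[\<dots> = 1 + int (Suc n) * int p * y] (mod int p ^ 2)"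
      by (simp add: cong_def)
    finally show ?case .
  qed simp
  obtain y where x: "x = 1 + int p * y"
    using assms by (metis cong_iff_lin cong_sym)
  have pp: "int ((p - 1) ^ 2) = 1 + int p * (int p - 2)"
  proof -
    have "int (p - 1) = int p - 1"
      using p_pos by simp
    then show ?thesis
      unfolding of_nat_power by (simp only: power2_eq_square) (simp add: algebra_simps)
  qed
  have "[x ^ ((p - 1) ^ 2) = 1 + int ((p - 1) ^ 2) * int p * y] (mod int p ^ 2)"
    unfolding x by (rule bern)
  also have "1 + int ((p - 1) ^ 2) * int p * y = x + int p ^ 2 * ((int p - 2) * y)"
    unfolding pp x by (simp add: algebra_simps power2_eq_square)
  also have "[\<dots> = x] (mod int p ^ 2)"
    by (simp add: cong_def)
  finally show ?thesis .
qed

text \<open>The link to formal Hilbert 90: on a subgroup where \<open>\<theta>\<close> is trivial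
  modulo \<open>p\<close>, its cocycles modulo \<open>p ^ 2\<close> are also cocycles for
  \<open>tw\<close>.\<close>

lemma tw_eq_theta:
  assumes "g \<in> carrier G" "\<theta> g 1 = 1"
  shows "[tw g = \<theta> g 2] (mod int p ^ 2)"
proof -
  have "[\<theta> g 2 = 1] (mod int p)"
    using theta_1_2[OF assms(1)] assms(2) by (metis cong_def mod_mod_trivial)
  then show ?thesis
    unfolding tw_def by (rule power_cong_square_of_cong_1)
qed

section \<open>Induced cocycles\<close>

text \<open>The explicit cocycle behind Shapiro's lemma. \<open>U\<close> models the cosets of
  \<open>N\<close> in \<open>H\<close>, with representatives \<open>C u\<close>; writing
  \<open>g \<otimes> C u\<close> as \<open>C (act g u) \<otimes> m\<close> with \<open>m\<close> in
  \<open>N\<close> turns a cocycle on \<open>N\<close> into one on \<open>H\<close> with values in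
  functions on \<open>U\<close>. The factor \<open>tw (C (act g u))\<close> carries the value of
  \<open>f\<close> to its coset. It serves both for the kernel of \<open>\<theta>\<close> modulo
  \<open>p\<close> and for the kernel of a homomorphism to Z/p.\<close>

lemma induced_cocycle:
  assumes N: "openin T N" "subgroup N G" and H: "subgroup H G" "openin T H"
    and f: "lc N f"
    and cocycle: "\<And>g h. g \<in> N \<Longrightarrow> h \<in> N \<Longrightarrow> [f (g \<otimes> h) = f g + tw g * f h] (mod int p ^ 2)"
    and act: "\<And>g h u. g \<in> H \<Longrightarrow> h \<in> H \<Longrightarrow> u \<in> U \<Longrightarrow> act (g \<otimes> h) u = act g (act h u)"
    and act_in: "\<And>g u. g \<in> H \<Longrightarrow> u \<in> U \<Longrightarrow> act g u \<in> U"
    and lc_act: "\<And>u. u \<in> U \<Longrightarrow> lc H (\<lambda>g. act g u)"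
    and rep: "\<And>u. u \<in> U \<Longrightarrow> C u \<in> H"
    and rep_N: "\<And>g u. g \<in> H \<Longrightarrow> u \<in> U \<Longrightarrow> inv (C (act g u)) \<otimes> g \<otimes> C u \<in> N"
  defines "k \<equiv> \<lambda>g u. tw (C (act g u)) * f (inv (C (act g u)) \<otimes> g \<otimes> C u)"
  shows "\<And>u. u \<in> U \<Longrightarrow> lc H (\<lambda>g. k g u)"
    and "\<And>g h u. g \<in> H \<Longrightarrow> h \<in> H \<Longrightarrow> u \<in> U \<Longrightarrow>
      [k (g \<otimes> h) u = tw g * k h u + k g (act h u)] (mod int p ^ 2)"
proof -
  fix u assume u: "u \<in> U"
  have HG: "x \<in> carrier G" if "x \<in> H" for x
    using that by (rule subgroup.mem_carrier[OF H(1)])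
  show "lc H (\<lambda>g. k g u)"
    unfolding k_def
  proof (rule locally_constant_on_pieces[where q = "\<lambda>g. act g u"
        and f = "\<lambda>w g. tw (C w) * f (inv (C w) \<otimes> g \<otimes> C u)"])
    fix w y
    show "openin T {g \<in> H. act g u = w \<and> tw (C w) * f (inv (C w) \<otimes> g \<otimes> C u) = y}"
    proof (cases "w \<in> U")
      case True
      \<comment> \<open>Once \<open>act g u = w\<close> is fixed, the representative
        \<open>C w\<close> is constant and \<open>f\<close> is merely composed with a two-sided
        translation.\<close>
      let ?A = "\<lambda>z. {g \<in> carrier G. inv (C w) \<otimes> g \<otimes> C u \<in> N \<and> f (inv (C w) \<otimes> g \<otimes> C u) = z}"
      have "{g \<in> H. act g u = w \<and> tw (C w) * f (inv (C w) \<otimes> g \<otimes> C u) = y} =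
          (\<Union>z\<in>{z. tw (C w) * z = y}. {g \<in> H. act g u = w} \<inter> ?A z)"
        using HG rep_N u by auto
      moreover have "openin T ({g \<in> H. act g u = w} \<inter> ?A z)" for z
        using lc_act[OF u] openin_translate[OF f N(1)] True u rep HG
        unfolding locally_constant_on_def by blast
      ultimately show ?thesis
        by (metis (no_types, lifting) imageE openin_Union)
    next
      case False
      then have empty: "{g \<in> H. act g u = w \<and> tw (C w) * f (inv (C w) \<otimes> g \<otimes> C u) = y} = {}"
        using act_in u by auto
      show ?thesis
        unfolding empty by (rule openin_empty)
    qed
  qed
next
  fix g h u assume gh: "g \<in> H" "h \<in> H" and u: "u \<in> U"
  have HG: "x \<in> carrier G" if "x \<in> H" for x
    using that by (rule subgroup.mem_carrier[OF H(1)])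
  define v where "v = act h u"
  define w where "w = act g v"
  have vw: "v \<in> U" "w \<in> U"
    using act_in gh u by (auto simp: v_def w_def)
  have car: "g \<in> carrier G" "h \<in> carrier G" "C u \<in> carrier G" "C v \<in> carrier G" "C w \<in> carrier G"
    by (intro HG rep gh u vw)+
  let ?m = "inv (C w) \<otimes> g \<otimes> C v" and ?n = "inv (C v) \<otimes> h \<otimes> C u"
  have mn: "?m \<in> N" "?n \<in> N"
    using rep_N gh u vw by (auto simp: v_def w_def)
  have prod: "?m \<otimes> ?n = inv (C w) \<otimes> (g \<otimes> h) \<otimes> C u"
  proof -
    have "C v \<otimes> (inv (C v) \<otimes> (h \<otimes> C u)) = h \<otimes> C u"
      using car by (simp add: m_assoc[symmetric])
    then show ?thesis
      using car by (simp add: m_assoc)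
  qed
  have kgh: "k (g \<otimes> h) u = tw (C w) * f (?m \<otimes> ?n)"
    unfolding prod by (simp add: k_def act[OF gh u] v_def w_def)
  have kg: "k g v = tw (C w) * f ?m" and kh: "k h u = tw (C v) * f ?n"
    by (simp_all add: k_def v_def w_def)
  \<comment> \<open>Evaluating \<open>tw\<close> on both factorizations of this element trades the
    twists of \<open>C w\<close> and \<open>?m\<close> for those of \<open>g\<close> and
    \<open>C v\<close>.\<close>
  have "C w \<otimes> ?m = g \<otimes> C v"
    using car by (simp add: m_assoc[symmetric])
  moreover have "[tw (C w \<otimes> ?m) = tw (C w) * tw ?m] (mod int p ^ 2)"
    "[tw (g \<otimes> C v) = tw g * tw (C v)] (mod int p ^ 2)"
    using car by (simp_all add: tw_mult)
  ultimately have tw_w: "[tw (C w) * tw ?m = tw g * tw (C v)] (mod int p ^ 2)"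
    by (simp add: cong_def)
  have "[k (g \<otimes> h) u = tw (C w) * (f ?m + tw ?m * f ?n)] (mod int p ^ 2)"
    unfolding kgh using cocycle[OF mn] by (rule cong_scalar_left)
  also have "tw (C w) * (f ?m + tw ?m * f ?n) = k g v + (tw (C w) * tw ?m) * f ?n"
    by (simp add: kg algebra_simps)
  also have "[\<dots> = k g v + (tw g * tw (C v)) * f ?n] (mod int p ^ 2)"
    by (intro cong_add cong_refl cong_scalar_right tw_w)
  also have "k g v + (tw g * tw (C v)) * f ?n = tw g * k h u + k g v"
    by (simp add: kh algebra_simps)
  finally show "[k (g \<otimes> h) u = tw g * k h u + k g (act h u)] (mod int p ^ 2)"
    by (simp add: v_def)
qed

section \<open>The kernel of the orientation modulo \<open>p\<close>\<close>

lemma theta_1_eq_1I: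
  assumes "x \<in> carrier G" "m \<in> carrier G" "\<theta> (x \<otimes> m) 1 = \<theta> x 1"
  shows "\<theta> m 1 = 1"
proof -
  have "[\<theta> x 1 * \<theta> m 1 = \<theta> x 1 * 1] (mod int p)"
  proof -
    have "(\<theta> x 1 * \<theta> m 1) mod int p = \<theta> x 1"
      using theta_mult[of 1 x m] assms by simp
    then show ?thesis
      unfolding cong_def by (metis mod_mod_trivial mult_1_right)
  qed
  then have "[\<theta> m 1 = 1] (mod int p)"
    using theta_props(2)[of 1 x] assms(1) cong_mult_lcancel by blast
  moreover have "\<theta> m 1 \<in> {0..<int p}"
    using theta_props(1)[of 1 m] assms(2) by simp
  ultimately show ?thesis
    using prime_gt_1_nat[OF prime_p] by (simp add: cong_def)
qed

lemma theta_1_in: "g \<in> carrier G \<Longrightarrow> \<theta> g 1 \<in> {1..<int p}"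
  using theta_props(1,2)[of 1 g] prime_gt_1_nat[OF prime_p]
  by (cases "\<theta> g 1 = 0") auto

lemma subgroup_theta_kernel:
  assumes "subgroup N G"
  shows "subgroup {g \<in> N. \<theta> g 1 = 1} G"
proof -
  have N: "g \<in> carrier G" if "g \<in> N" for g
    using that by (rule subgroup.mem_carrier[OF assms])
  have one: "\<theta> \<one> 1 = 1"
    by (rule theta_1_eq_1I[of \<one> \<one>]) auto
  show ?thesis
  proof
    show "{g \<in> N. \<theta> g 1 = 1} \<subseteq> carrier G"
      using N by auto
    show "\<one> \<in> {g \<in> N. \<theta> g 1 = 1}"
      using one subgroup.one_closed[OF assms] by simp
  next
    fix g h assume gh: "g \<in> {g \<in> N. \<theta> g 1 = 1}" "h \<in> {g \<in> N. \<theta> g 1 = 1}"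
    then have "\<theta> (g \<otimes> h) 1 = 1"
      using theta_mult[of 1 g h] N prime_gt_1_nat[OF prime_p] by simp
    then show "g \<otimes> h \<in> {g \<in> N. \<theta> g 1 = 1}"
      using gh subgroup.m_closed[OF assms] by simp
  next
    fix g assume g: "g \<in> {g \<in> N. \<theta> g 1 = 1}"
    then have "\<theta> (inv g) 1 = 1"
      using one N by (intro theta_1_eq_1I[of g]) auto
    then show "inv g \<in> {g \<in> N. \<theta> g 1 = 1}"
      using g subgroup.m_inv_closed[OF assms] by simp
  qed
qed

lemma openin_theta_kernel:
  assumes "openin T N" "N \<subseteq> carrier G"
  shows "openin T {g \<in> N. \<theta> g 1 = 1}"
  using locally_constant_on_subset[OF lc_theta[of 1] assms] by (simp add: locally_constant_on_def)

section \<open>Lifting homomorphisms from open subgroups\<close>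

text \<open>The action modulo \<open>p\<close> is trivial here, so a homomorphism is a twisted
  cocycle and formal Hilbert 90 with \<open>n = 2\<close> applies.\<close>

lemma hom_lift_theta_kernel:
  assumes N: "subgroup N G" "openin T N" and f: "lc N f"
    and hom: "\<And>g h. g \<in> N \<Longrightarrow> h \<in> N \<Longrightarrow> [f (g \<otimes> h) = f g + f h] (mod int p)"
    and theta: "\<And>g. g \<in> N \<Longrightarrow> \<theta> g 1 = 1"
  obtains F where "lc N F"
    "\<And>g h. g \<in> N \<Longrightarrow> h \<in> N \<Longrightarrow> [F (g \<otimes> h) = F g + tw g * F h] (mod int p ^ 2)"
    "\<And>g. g \<in> N \<Longrightarrow> [F g = f g] (mod int p)"
proof -
  have NG: "g \<in> carrier G" if "g \<in> N" for g
    using that by (rule subgroup.mem_carrier[OF N(1)])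
  have "twisted_cocycle1 p G T \<theta> N 1 (\<lambda>g. f g mod int p)"
    unfolding twisted_cocycle1_def cochain1_on_def
    using locally_constant_on_compose[OF f, of "\<lambda>x. x mod int p"] hom theta p_pos
    by (auto simp: continuous_map_subtopology_disc_iff[OF N(2)] cong_def mod_add_eq)
  then obtain F c where F: "twisted_cocycle1 p G T \<theta> N 2 F"
    and Ff: "\<forall>h\<in>N. f h mod int p = (F h mod int p + (\<theta> h 1 * c - c)) mod int p"
    using hilbert90 N unfolding formal_hilbert90_def by (meson one_le_numeral)
  show thesis
  proof (rule that[of F])
    show "lc N F"
      using F by (simp add: twisted_cocycle1_def cochain1_on_def
          continuous_map_subtopology_disc_iff[OF N(2)])
    show "[F (g \<otimes> h) = F g + tw g * F h] (mod int p ^ 2)" if "g \<in> N" "h \<in> N" for g h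
    proof -
      have "[F (g \<otimes> h) = F g + \<theta> g 2 * F h] (mod int p ^ 2)"
        using F that by (simp add: twisted_cocycle1_def cong_def)
      also have "[F g + \<theta> g 2 * F h = F g + tw g * F h] (mod int p ^ 2)"
        by (intro cong_add cong_refl cong_scalar_right cong_sym[OF tw_eq_theta] NG theta that)
      finally show ?thesis .
    qed
    \<comment> \<open>The coboundary term \<open>\<theta> g 1 * c - c\<close> vanishes because
      \<open>\<theta> g 1 = 1\<close>.\<close>
    show "[F g = f g] (mod int p)" if "g \<in> N" for g
      using Ff theta that by (simp add: cong_def)
  qed
qed

text \<open>Corestriction from the kernel \<open>K\<close> of \<open>\<theta>\<close> modulo
  \<open>p\<close>: its index in \<open>N\<close> is less than \<open>p\<close>, so restriction
  followed by corestriction multiplies a class modulo \<open>p\<close> by a unit, which is then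
  divided out.\<close>

lemma hom_lift:
  assumes N: "subgroup N G" "openin T N" and f: "lc N f"
    and hom: "\<And>g h. g \<in> N \<Longrightarrow> h \<in> N \<Longrightarrow> [f (g \<otimes> h) = f g + f h] (mod int p)"
  obtains F where "lc N F"
    "\<And>g h. g \<in> N \<Longrightarrow> h \<in> N \<Longrightarrow> [F (g \<otimes> h) = F g + tw g * F h] (mod int p ^ 2)"
    "\<And>g. g \<in> N \<Longrightarrow> [F g = f g] (mod int p)"
proof -
  have NG: "g \<in> carrier G" if "g \<in> N" for g
    using that by (rule subgroup.mem_carrier[OF N(1)])
  define K where "K = {g \<in> N. \<theta> g 1 = 1}"
  have KN: "K \<subseteq> N" and K: "subgroup K G" "openin T K"
    using subgroup_theta_kernel[OF N(1)] openin_theta_kernel[OF N(2)] NG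
    by (auto simp: K_def)
  obtain F' where F': "lc K F'"
    "\<And>g h. g \<in> K \<Longrightarrow> h \<in> K \<Longrightarrow> [F' (g \<otimes> h) = F' g + tw g * F' h] (mod int p ^ 2)"
    "\<And>g. g \<in> K \<Longrightarrow> [F' g = f g] (mod int p)"
  proof (rule hom_lift_theta_kernel[OF K locally_constant_on_subset[OF f K(2) KN]])
    show "[f (g \<otimes> h) = f g + f h] (mod int p)" if "g \<in> K" "h \<in> K" for g h
      using that hom by (simp add: K_def)
  qed (auto simp: K_def)
  \<comment> \<open>The image of \<open>N\<close> among the units modulo \<open>p\<close> models the
    cosets of \<open>K\<close>, with \<open>N\<close> acting by multiplication.\<close>
  define U where "U = (\<lambda>g. \<theta> g 1) ` N"
  define C where "C = inv_into N (\<lambda>g. \<theta> g 1)"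
  define act where "act = (\<lambda>g u. (\<theta> g 1 * u) mod int p)"
  have C: "C u \<in> N" "\<theta> (C u) 1 = u" if "u \<in> U" for u
    using that inv_into_into[of u "\<lambda>g. \<theta> g 1" N] f_inv_into_f[of u "\<lambda>g. \<theta> g 1" N]
    by (simp_all add: U_def C_def)
  have U: "U \<subseteq> {1..<int p}"
    using theta_1_in NG by (auto simp: U_def)
  have act_theta: "act g (\<theta> x 1) = \<theta> (g \<otimes> x) 1" if "g \<in> N" "x \<in> N" for g x
    using theta_mult[of 1 g x] that NG by (simp add: act_def)
  have act_in: "act g u \<in> U" if "g \<in> N" "u \<in> U" for g u
    using that act_theta subgroup.m_closed[OF N(1)] by (auto simp: U_def)
  have act_mult: "act (g \<otimes> h) u = act g (act h u)" if "g \<in> N" "h \<in> N" "u \<in> U" for g h u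
    using that theta_mult[of 1 g h] NG by (simp add: act_def mod_mult_left_eq mod_mult_right_eq mult.assoc)
  have act_one: "act \<one> u = u" if "u \<in> U" for u
    using that act_theta[OF subgroup.one_closed[OF N(1)]] NG by (auto simp: U_def)
  have bij: "bij_betw (act h) U U" if h: "h \<in> N" for h
  proof (rule bij_betw_byWitness[where f' = "act (inv h)"])
    have h': "inv h \<in> N"
      using h by (rule subgroup.m_inv_closed[OF N(1)])
    show "\<forall>u\<in>U. act (inv h) (act h u) = u"
      using act_mult[OF h' h] act_one NG h by (metis l_inv)
    show "\<forall>u\<in>U. act h (act (inv h) u) = u"
      using act_mult[OF h h'] act_one NG h by (metis r_inv)
    show "act h ` U \<subseteq> U" "act (inv h) ` U \<subseteq> U"
      using act_in h h' by auto
  qed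
  have lc_act: "lc N (\<lambda>g. act g u)" for u
  proof -
    have "N \<subseteq> carrier G"
      using NG by auto
    from locally_constant_on_compose[OF locally_constant_on_subset[OF lc_theta[of 1] N(2) this],
        of "\<lambda>x. (x * u) mod int p"]
    show ?thesis
      by (simp add: act_def)
  qed
  have quot: "C (act g u) \<otimes> (inv (C (act g u)) \<otimes> g \<otimes> C u) = g \<otimes> C u"
    if "g \<in> N" "u \<in> U" for g u
    using NG[OF that(1)] NG[OF C(1)[OF that(2)]] NG[OF C(1)[OF act_in[OF that]]]
    by (simp add: m_assoc[symmetric])
  have rep_K: "inv (C (act g u)) \<otimes> g \<otimes> C u \<in> K" if "g \<in> N" "u \<in> U" for g u
  proof -
    have N': "inv (C (act g u)) \<otimes> g \<otimes> C u \<in> N"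
      by (intro subgroup.m_closed[OF N(1)] subgroup.m_inv_closed[OF N(1)] that C(1) act_in)
    have "\<theta> (C (act g u) \<otimes> (inv (C (act g u)) \<otimes> g \<otimes> C u)) 1 = \<theta> (C (act g u)) 1"
      using act_theta[OF that(1) C(1)[OF that(2)]] C(2)[OF that(2)] C(2)[OF act_in[OF that]]
      unfolding quot[OF that] by simp
    then have "\<theta> (inv (C (act g u)) \<otimes> g \<otimes> C u) 1 = 1"
      by (rule theta_1_eq_1I[OF NG[OF C(1)[OF act_in[OF that]]] NG[OF N']])
    with N' show ?thesis
      by (simp add: K_def)
  qed
  define k where "k = (\<lambda>g u. tw (C (act g u)) * F' (inv (C (act g u)) \<otimes> g \<otimes> C u))"
  have lc_k: "lc N (\<lambda>g. k g u)"
    and k_mult: "\<And>g h. g \<in> N \<Longrightarrow> h \<in> N \<Longrightarrow>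
      [k (g \<otimes> h) u = tw g * k h u + k g (act h u)] (mod int p ^ 2)" if "u \<in> U" for u
    unfolding k_def
    using induced_cocycle[where act = act and C = C, OF K(2,1) N F'(1,2) act_mult act_in lc_act C(1) rep_K]
      that by blast+
  \<comment> \<open>The values of \<open>f\<close> at the two representatives form a coboundary,
    which cancels in the sum over \<open>U\<close>.\<close>
  have k_mod: "[k g u = f g + f (C u) - f (C (act g u))] (mod int p)" if "g \<in> N" "u \<in> U" for g u
  proof -
    let ?m = "inv (C (act g u)) \<otimes> g \<otimes> C u"
    have m: "?m \<in> K" "?m \<in> N" "C (act g u) \<in> N" "C u \<in> N"
      using rep_K[OF that] KN C act_in that by auto
    have "[f (C (act g u)) + f ?m = f g + f (C u)] (mod int p)"
      using hom[OF m(3,2)] hom[OF that(1) m(4)] unfolding quot[OF that] by (metis cong_sym cong_trans)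
    then have "[f ?m = f g + f (C u) - f (C (act g u))] (mod int p)"
      by (simp add: cong_iff_dvd_diff algebra_simps)
    moreover have "[k g u = 1 * f ?m] (mod int p)"
      unfolding k_def using m F'(3) tw_cong_1 NG by (intro cong_mult) auto
    ultimately show ?thesis
      by (metis cong_trans mult_1)
  qed
  \<comment> \<open>The sum over all cosets is the corestriction; since \<open>act h\<close>
    permutes \<open>U\<close>, it satisfies the twisted cocycle relation.\<close>
  define S where "S = (\<lambda>g. \<Sum>u\<in>U. k g u)"
  have finU: "finite U"
    using U finite_subset by blast
  have S_mult: "[S (g \<otimes> h) = S g + tw g * S h] (mod int p ^ 2)" if "g \<in> N" "h \<in> N" for g h
  proof -
    have "[S (g \<otimes> h) = (\<Sum>u\<in>U. tw g * k h u + k g (act h u))] (mod int p ^ 2)"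
      unfolding S_def using k_mult that by (intro cong_sum) auto
    also have "(\<Sum>u\<in>U. tw g * k h u + k g (act h u)) = S g + tw g * S h"
      unfolding S_def using sum.reindex_bij_betw[OF bij[OF that(2)], of "k g"]
      by (simp add: sum.distrib sum_distrib_left)
    finally show ?thesis .
  qed
  have S_mod: "[S g = int (card U) * f g] (mod int p)" if "g \<in> N" for g
  proof -
    have "[S g = (\<Sum>u\<in>U. f g + f (C u) - f (C (act g u)))] (mod int p)"
      unfolding S_def using k_mod that by (intro cong_sum) auto
    also have "(\<Sum>u\<in>U. f g + f (C u) - f (C (act g u))) = int (card U) * f g"
      using sum.reindex_bij_betw[OF bij[OF that], of "\<lambda>u. f (C u)"]
      by (simp add: sum.distrib sum_subtractf)
    finally show ?thesis .
  qed
  have "card U \<le> card {1..<int p}"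
    using U by (intro card_mono) auto
  moreover have "U \<noteq> {}"
    using subgroup.one_closed[OF N(1)] by (auto simp: U_def)
  ultimately have "0 < card U" "card U < p"
    using finU p_pos by (auto simp: card_gt_0_iff)
  then have "coprime (int (card U)) (int p)"
    using prime_p by (metis coprime_commute coprime_int_iff nat_dvd_not_less prime_imp_coprime)
  then obtain e where e: "[int (card U) * e = 1] (mod int p)"
    using cong_solve_coprime_int by blast
  show thesis
  proof (rule that[of "\<lambda>g. e * S g"])
    show "lc N (\<lambda>g. e * S g)"
      unfolding S_def
      by (intro locally_constant_on_compose[where F = "\<lambda>x. e * x"] locally_constant_on_sum N(2) finU lc_k)
    show "[e * S (g \<otimes> h) = e * S g + tw g * (e * S h)] (mod int p ^ 2)" if "g \<in> N" "h \<in> N" for g h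
      using cong_scalar_left[OF S_mult[OF that], of e] by (simp add: algebra_simps)
    show "[e * S g = f g] (mod int p)" if "g \<in> N" for g
    proof -
      have "[e * S g = e * (int (card U) * f g)] (mod int p)"
        using S_mod[OF that] by (rule cong_scalar_left)
      also have "e * (int (card U) * f g) = (int (card U) * e) * f g"
        by simp
      also have "[\<dots> = 1 * f g] (mod int p)"
        using e by (rule cong_scalar_right)
      finally show ?thesis by simp
    qed
  qed
qed

section \<open>Shapiro's lemma for a homomorphism to Z/p\<close>

lemma subgroup_hom_kernel:
  assumes "\<And>g h. g \<in> carrier G \<Longrightarrow> h \<in> carrier G \<Longrightarrow> [X (g \<otimes> h) = X g + X h] (mod int p)"
  shows "subgroup {g \<in> carrier G. [X g = 0] (mod int p)} G"
proof -
  have one: "[X \<one> = 0] (mod int p)"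
    using assms[of \<one> \<one>] by (simp add: cong_iff_dvd_diff)
  show ?thesis
  proof
    fix g h assume gh: "g \<in> {g \<in> carrier G. [X g = 0] (mod int p)}"
      "h \<in> {g \<in> carrier G. [X g = 0] (mod int p)}"
    then have "[X (g \<otimes> h) = 0] (mod int p)"
      using cong_trans[OF assms cong_add[of "X g" 0 "int p" "X h" 0]] by simp
    then show "g \<otimes> h \<in> {g \<in> carrier G. [X g = 0] (mod int p)}"
      using gh by simp
  next
    fix g assume g: "g \<in> {g \<in> carrier G. [X g = 0] (mod int p)}"
    then have "[0 + X (inv g) = 0] (mod int p)"
      using assms[of g "inv g"] one
      by (metis (mono_tags, lifting) cong_add_rcancel cong_sym cong_trans inv_closed mem_Collect_eq r_inv)
    then show "inv g \<in> {g \<in> carrier G. [X g = 0] (mod int p)}"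
      using g by simp
  qed (use one in auto)
qed

lemma hom_pow:
  assumes "\<And>g h. g \<in> carrier G \<Longrightarrow> h \<in> carrier G \<Longrightarrow> [X (g \<otimes> h) = X g + X h] (mod int p)"
    and "s \<in> carrier G"
  shows "[X (s [^] n) = int n * X s] (mod int p)"
proof (induction n)
  case 0
  then show ?case
    using assms(1)[of \<one> \<one>] by (simp add: cong_iff_dvd_diff)
next
  case (Suc n)
  have "[X (s [^] Suc n) = X (s [^] n) + X s] (mod int p)"
    using assms by simp
  also have "[X (s [^] n) + X s = int n * X s + X s] (mod int p)"
    using Suc by (intro cong_add cong_refl)
  finally show ?case
    by (simp add: algebra_simps)
qed

text \<open>A nonzero value is invertible modulo the prime \<open>p\<close>, so suitable powers of
  the single element \<open>s\<close> reach every residue.\<close>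

lemma hom_surj:
  assumes X: "\<And>g h. g \<in> carrier G \<Longrightarrow> h \<in> carrier G \<Longrightarrow> [X (g \<otimes> h) = X g + X h] (mod int p)"
    and s: "s \<in> carrier G" "\<not> [X s = 0] (mod int p)"
  obtains C where "\<And>u. C u \<in> carrier G" "\<And>u. [X (C u) = u] (mod int p)"
proof -
  have "coprime (X s) (int p)"
    using s(2) prime_p prime_imp_coprime[of "int p" "X s"]
    by (auto simp: cong_0_iff coprime_commute)
  then obtain e where e: "[X s * e = 1] (mod int p)"
    using cong_solve_coprime_int by blast
  define C where "C = (\<lambda>u. s [^] nat ((e * u) mod int p))"
  have "[X (C u) = u] (mod int p)" for u
  proof -
    have "[X (C u) = (e * u) mod int p * X s] (mod int p)"
      using hom_pow[OF X s(1), where n = "nat ((e * u) mod int p)"] p_pos by (simp add: C_def)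
    also have "[(e * u) mod int p * X s = (e * u) * X s] (mod int p)"
      by (intro cong_scalar_right) simp
    also have "(e * u) * X s = (X s * e) * u"
      by simp
    also have "[\<dots> = 1 * u] (mod int p)"
      using e by (rule cong_scalar_right)
    finally show ?thesis by simp
  qed
  then show thesis
    using that[of C] s(1) by (simp add: C_def)
qed

text \<open>Translation by \<open>X h\<close> does nothing modulo \<open>p\<close>, so each
  \<open>c - u * x2\<close> is itself a homomorphism modulo \<open>p\<close> and is lifted on its
  own.\<close>

lemma shapiro_lift_trivial:
  assumes X: "\<And>g. g \<in> carrier G \<Longrightarrow> [X g = 0] (mod int p)"
    and lc2: "lc (carrier G) x2"
    and x2: "\<And>g h. g \<in> carrier G \<Longrightarrow> h \<in> carrier G \<Longrightarrow> [x2 (g \<otimes> h) = x2 g + x2 h] (mod int p)"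
    and lcc: "lc (carrier G) c"
    and c: "\<And>g h. g \<in> carrier G \<Longrightarrow> h \<in> carrier G \<Longrightarrow>
      [c (g \<otimes> h) = c g + c h - X h * x2 g] (mod int p)"
  obtains k where "\<And>u. lc (carrier G) (\<lambda>g. k g u)"
    "\<And>g u. k g (u mod int p) = k g u"
    "\<And>g h u. g \<in> carrier G \<Longrightarrow> h \<in> carrier G \<Longrightarrow>
      [k (g \<otimes> h) u = tw g * k h u + k g (u + X h)] (mod int p ^ 2)"
    "\<And>g u. g \<in> carrier G \<Longrightarrow> [k g u = c g - u * x2 g] (mod int p)"
proof -
  have "\<exists>F. lc (carrier G) F \<and>
    (\<forall>g\<in>carrier G. \<forall>h\<in>carrier G. [F (g \<otimes> h) = F g + tw g * F h] (mod int p ^ 2)) \<and>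
    (\<forall>g\<in>carrier G. [F g = c g - u * x2 g] (mod int p))" for u
  proof -
    have hom: "[c (g \<otimes> h) - u * x2 (g \<otimes> h) = (c g - u * x2 g) + (c h - u * x2 h)] (mod int p)"
      if gh: "g \<in> carrier G" "h \<in> carrier G" for g h
    proof -
      have "[X h * x2 g = 0] (mod int p)"
        using X[OF gh(2)] by (simp add: cong_0_iff)
      then have "[c (g \<otimes> h) - u * x2 (g \<otimes> h) = c g + c h - 0 - u * (x2 g + x2 h)] (mod int p)"
        by (intro cong_diff cong_scalar_left x2 gh cong_trans[OF c[OF gh]] cong_refl)
      then show ?thesis
        by (simp add: algebra_simps)
    qed
    have lcu: "lc (carrier G) (\<lambda>g. c g - u * x2 g)"
      using locally_constant_on_compose2[OF lcc lc2, of "\<lambda>a b. a - u * b"] .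
    show ?thesis
      using hom_lift[OF subgroup_self openin_carrier lcu hom] by metis
  qed
  then obtain F where F: "\<And>u. lc (carrier G) (F u)"
    "\<And>u g h. g \<in> carrier G \<Longrightarrow> h \<in> carrier G \<Longrightarrow> [F u (g \<otimes> h) = F u g + tw g * F u h] (mod int p ^ 2)"
    "\<And>u g. g \<in> carrier G \<Longrightarrow> [F u g = c g - u * x2 g] (mod int p)"
    by metis
  \<comment> \<open>Reducing the index first selects one lift per residue class, which makes
    \<open>k\<close> periodic.\<close>
  show thesis
  proof (rule that[of "\<lambda>g u. F (u mod int p) g"])
    show "lc (carrier G) (F (u mod int p))" for u
      by (rule F)
    show "F (u mod int p mod int p) g = F (u mod int p) g" for g u
      by simp
    show "[F (u mod int p) (g \<otimes> h) = tw g * F (u mod int p) h + F ((u + X h) mod int p) g]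
        (mod int p ^ 2)" if "g \<in> carrier G" "h \<in> carrier G" for g h u
    proof -
      have "(u + X h) mod int p = u mod int p"
        using cong_add[OF cong_refl[of u] X[OF that(2)]] by (simp add: cong_def)
      then show ?thesis
        using F(2)[OF that, of "u mod int p"] by (simp add: add.commute)
    qed
    show "[F (u mod int p) g = c g - u * x2 g] (mod int p)" if "g \<in> carrier G" for g u
    proof -
      have "[F (u mod int p) g = c g - (u mod int p) * x2 g] (mod int p)"
        using that by (rule F)
      also have "[c g - (u mod int p) * x2 g = c g - u * x2 g] (mod int p)"
        by (intro cong_diff cong_refl cong_scalar_right) simp
      finally show ?thesis .
    qed
  qed
qed

text \<open>On the kernel \<open>N\<close> of \<open>X\<close> the cochain \<open>c\<close>, the
  value of the desired cocycle at \<open>u = 0\<close>, is a homomorphism. Its lift \<open>f\<close>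
  is induced to \<open>G\<close>; modulo \<open>p\<close> the result \<open>j\<close> is the desired
  cocycle up to a coboundary, and that coboundary lifts as well.\<close>

lemma shapiro_lift_surj:
  assumes lcX: "lc (carrier G) X"
    and X: "\<And>g h. g \<in> carrier G \<Longrightarrow> h \<in> carrier G \<Longrightarrow> [X (g \<otimes> h) = X g + X h] (mod int p)"
    and C: "\<And>u. C u \<in> carrier G" "\<And>u. [X (C u) = u] (mod int p)"
    and lcc: "lc (carrier G) c"
    and c: "\<And>g h. g \<in> carrier G \<Longrightarrow> h \<in> carrier G \<Longrightarrow>
      [c (g \<otimes> h) = c g + c h - X h * x2 g] (mod int p)"
  obtains k where "\<And>u. lc (carrier G) (\<lambda>g. k g u)"
    "\<And>g u. k g (u mod int p) = k g u"
    "\<And>g h u. g \<in> carrier G \<Longrightarrow> h \<in> carrier G \<Longrightarrow>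
      [k (g \<otimes> h) u = tw g * k h u + k g (u + X h)] (mod int p ^ 2)"
    "\<And>g u. g \<in> carrier G \<Longrightarrow> [k g u = c g - u * x2 g] (mod int p)"
proof -
  define N where "N = {g \<in> carrier G. [X g = 0] (mod int p)}"
  have N: "subgroup N G"
    unfolding N_def using X by (rule subgroup_hom_kernel)
  have NG: "N \<subseteq> carrier G"
    by (auto simp: N_def)
  have N_open: "openin T N"
  proof -
    have "lc (carrier G) (\<lambda>g. X g mod int p)"
      by (rule locally_constant_on_compose[OF lcX])
    then show ?thesis
      unfolding N_def by (simp add: locally_constant_on_def cong_def)
  qed
  obtain f where f: "lc N f"
    "\<And>g h. g \<in> N \<Longrightarrow> h \<in> N \<Longrightarrow> [f (g \<otimes> h) = f g + tw g * f h] (mod int p ^ 2)"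
    "\<And>g. g \<in> N \<Longrightarrow> [f g = c g] (mod int p)"
  proof (rule hom_lift[OF N N_open locally_constant_on_subset[OF lcc N_open NG]])
    show "[c (g \<otimes> h) = c g + c h] (mod int p)" if "g \<in> N" "h \<in> N" for g h
    proof -
      have "[X h * x2 g = 0] (mod int p)"
        using that by (simp add: N_def cong_0_iff)
      then have "[c g + c h - X h * x2 g = c g + c h - 0] (mod int p)"
        by (intro cong_diff cong_refl)
      then show ?thesis
        using cong_trans[OF c] that NG by (simp add: subsetD)
    qed
  qed blast
  define U where "U = {0..<int p}"
  define act where "act = (\<lambda>g u. (u + X g) mod int p)"
  have act_mult: "act (g \<otimes> h) u = act g (act h u)" if "g \<in> carrier G" "h \<in> carrier G" for g h u
  proof -
    have "[u + X (g \<otimes> h) = u + (X h + X g)] (mod int p)"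
      using X[OF that] by (intro cong_add cong_refl) (simp add: add.commute)
    then show ?thesis
      by (simp add: act_def cong_def mod_add_left_eq add.assoc)
  qed
  have act_in: "act g u \<in> U" for g u
    using p_pos by (simp add: act_def U_def)
  have lc_act: "lc (carrier G) (\<lambda>g. act g u)" for u
    using locally_constant_on_compose[OF lcX, of "\<lambda>x. (u + x) mod int p"] by (simp add: act_def)
  have quot: "C (act g u) \<otimes> (inv (C (act g u)) \<otimes> g \<otimes> C u) = g \<otimes> C u"
    if "g \<in> carrier G" for g u
    using that C(1) by (simp add: m_assoc[symmetric])
  have rep_N: "inv (C (act g u)) \<otimes> g \<otimes> C u \<in> N" if "g \<in> carrier G" for g u
  proof -
    let ?m = "inv (C (act g u)) \<otimes> g \<otimes> C u"
    have m: "?m \<in> carrier G"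
      using that C(1) by simp
    have "[X (C (act g u)) + X ?m = X g + X (C u)] (mod int p)"
      using X[OF C(1) m, of "act g u"] X[OF that C(1), of u] unfolding quot[OF that]
      by (metis cong_sym cong_trans)
    also have "[X g + X (C u) = u + X g] (mod int p)"
      using C(2)[of u] by (metis add.commute cong_add_lcancel)
    also have "[u + X g = act g u] (mod int p)"
      by (simp add: act_def)
    also have "[act g u = X (C (act g u))] (mod int p)"
      using C(2) by (rule cong_sym)
    finally have "[X ?m = 0] (mod int p)"
      by (simp add: cong_iff_dvd_diff)
    then show ?thesis
      using m by (simp add: N_def)
  qed
  define j where "j = (\<lambda>g u. tw (C (act g u)) * f (inv (C (act g u)) \<otimes> g \<otimes> C u))"
  have lc_j: "lc (carrier G) (\<lambda>g. j g u)"
    and j_mult: "\<And>g h. g \<in> carrier G \<Longrightarrow> h \<in> carrier G \<Longrightarrow>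
      [j (g \<otimes> h) u = tw g * j h u + j g (act h u)] (mod int p ^ 2)" if "u \<in> U" for u
    unfolding j_def
    using induced_cocycle[where act = act and C = C and U = U,
        OF N_open N subgroup_self openin_carrier f(1,2) act_mult act_in lc_act C(1) rep_N] that
    by blast+
  \<comment> \<open>The correction is the coboundary of the function \<open>c (C u)\<close> of
    \<open>u\<close>, formed with the twist \<open>tw\<close> so that the cocycle relation holds
    modulo \<open>p ^ 2\<close>.\<close>
  define k where "k = (\<lambda>g u. c (C (act g u)) - tw g * c (C (u mod int p)) + j g (u mod int p))"
  have mod_U: "u mod int p \<in> U" for u
    using p_pos by (simp add: U_def)
  have act_mod: "act g (u mod int p) = act g u" for g u
    by (simp add: act_def mod_add_left_eq)
  show thesis
  proof (rule that[of k])
    show "lc (carrier G) (\<lambda>g. k g u)" for u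
      using locally_constant_on_compose2[OF lc_j[OF mod_U[of u]]
          locally_constant_on_compose2[OF lc_act[of u] lc_tw, of "\<lambda>v t. c (C v) - t * c (C (u mod int p))"],
          of "\<lambda>x y. y + x"]
      by (simp add: k_def)
    show "k g (u mod int p) = k g u" for g u
      by (simp add: k_def act_mod)
    show "[k (g \<otimes> h) u = tw g * k h u + k g (u + X h)] (mod int p ^ 2)"
      if gh: "g \<in> carrier G" "h \<in> carrier G" for g h u
    proof -
      have kg: "k g (u + X h) = c (C (act (g \<otimes> h) u)) - tw g * c (C (act h u)) + j g (act h u)"
        using act_mod[of g "u + X h"] act_mult[OF gh] unfolding k_def by (simp add: act_def)
      have jgh: "[j (g \<otimes> h) (u mod int p) = tw g * j h (u mod int p) + j g (act h u)] (mod int p ^ 2)"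
        using j_mult[OF mod_U gh] by (simp add: act_mod)
      have "[k (g \<otimes> h) u = c (C (act (g \<otimes> h) u)) - (tw g * tw h) * c (C (u mod int p)) +
          (tw g * j h (u mod int p) + j g (act h u))] (mod int p ^ 2)"
        unfolding k_def by (intro cong_add cong_diff cong_refl cong_scalar_right tw_mult gh jgh)
      also have "c (C (act (g \<otimes> h) u)) - (tw g * tw h) * c (C (u mod int p)) +
          (tw g * j h (u mod int p) + j g (act h u)) = tw g * k h u + k g (u + X h)"
        unfolding kg by (simp add: k_def algebra_simps)
      finally show ?thesis .
    qed
    show "[k g u = c g - u * x2 g] (mod int p)" if g: "g \<in> carrier G" for g u
    proof -
      define v where "v = u mod int p"
      let ?m = "inv (C (act g v)) \<otimes> g \<otimes> C v"
      have m: "?m \<in> N" "?m \<in> carrier G"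
        using rep_N[OF g] NG by auto
      \<comment> \<open>Compute \<open>c\<close> on
        \<open>C (act g v) \<otimes> ?m = g \<otimes> C v\<close> in two ways: \<open>X ?m\<close>
        vanishes on one side, and \<open>X (C v)\<close> supplies \<open>u * x2 g\<close> on the
        other.\<close>
      have "[X ?m = 0] (mod int p)"
        using m(1) by (simp add: N_def)
      note cm = cong_trans[OF c[OF C(1)[of "act g v"] m(2)] cong_diff[OF cong_refl cong_scalar_right[OF this]]]
      have "[X (C v) = u] (mod int p)"
        using C(2)[of v] by (simp add: v_def cong_def)
      note cg = cong_trans[OF c[OF g C(1)] cong_diff[OF cong_refl cong_scalar_right[OF this]]]
      have "k g u = c (C (act g v)) - tw g * c (C v) + tw (C (act g v)) * f ?m"
        by (simp add: k_def j_def v_def act_mod)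
      also have "[\<dots> = c (C (act g v)) - 1 * c (C v) + 1 * c ?m] (mod int p)"
      proof (rule cong_add[OF cong_diff[OF cong_refl cong_scalar_right]])
        show "[tw g = 1] (mod int p)"
          using g by (rule tw_cong_1)
        show "[tw (C (act g v)) * f ?m = 1 * c ?m] (mod int p)"
          using m(1) by (rule cong_mult[OF tw_cong_1[OF C(1)] f(3)])
      qed
      also have "[c (C (act g v)) - 1 * c (C v) + 1 * c ?m = c g - u * x2 g] (mod int p)"
        using cong_trans[OF cong_sym[OF cm[unfolded quot[OF g]]] cg]
        by (simp add: cong_iff_dvd_diff algebra_simps)
      finally show ?thesis .
    qed
  qed
qed

text \<open>The map \<open>k\<close> is a cocycle with values in the functions \<open>\<int>/p \<rightarrow> \<int>/p\<^sup>2\<close>: the second argument is an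
  integer, and \<open>k g\<close> is periodic in it.\<close>

lemma shapiro_lift:
  assumes lcX: "lc (carrier G) X"
    and X: "\<And>g h. g \<in> carrier G \<Longrightarrow> h \<in> carrier G \<Longrightarrow> [X (g \<otimes> h) = X g + X h] (mod int p)"
    and lc2: "lc (carrier G) x2"
    and x2: "\<And>g h. g \<in> carrier G \<Longrightarrow> h \<in> carrier G \<Longrightarrow> [x2 (g \<otimes> h) = x2 g + x2 h] (mod int p)"
    and lcc: "lc (carrier G) c"
    and c: "\<And>g h. g \<in> carrier G \<Longrightarrow> h \<in> carrier G \<Longrightarrow>
      [c (g \<otimes> h) = c g + c h - X h * x2 g] (mod int p)"
  obtains k where "\<And>u. lc (carrier G) (\<lambda>g. k g u)"
    "\<And>g u. k g (u mod int p) = k g u"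
    "\<And>g h u. g \<in> carrier G \<Longrightarrow> h \<in> carrier G \<Longrightarrow>
      [k (g \<otimes> h) u = tw g * k h u + k g (u + X h)] (mod int p ^ 2)"
    "\<And>g u. g \<in> carrier G \<Longrightarrow> [k g u = c g - u * x2 g] (mod int p)"
proof (cases "\<forall>g\<in>carrier G. [X g = 0] (mod int p)")
  case True
  show thesis
    by (rule shapiro_lift_trivial[OF True[rule_format] lc2 x2 lcc c that])
next
  case False
  then obtain s where s: "s \<in> carrier G" "\<not> [X s = 0] (mod int p)"
    by blast
  obtain C where C: "\<And>u. C u \<in> carrier G" "\<And>u. [X (C u) = u] (mod int p)"
    using hom_surj[OF X s] by blast
  show thesis
    by (rule shapiro_lift_surj[OF lcX X C lcc c that])
qed

section \<open>Triple Massey products\<close>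

text \<open>In the weighted sum of the cocycle relation the translation by \<open>X h\<close>
  survives. The plain sum runs over a full period and forgets it, leaving an ordinary twisted
  cocycle.\<close>

lemma moment_mult:
  assumes per: "\<And>g u. k g (u mod int p) = k g u"
    and k: "\<And>g h u. g \<in> carrier G \<Longrightarrow> h \<in> carrier G \<Longrightarrow>
      [k (g \<otimes> h) u = tw g * k h u + k g (u + X h)] (mod int p ^ 2)"
    and gh: "g \<in> carrier G" "h \<in> carrier G"
  shows "[moment p (k (g \<otimes> h)) x = tw g * moment p (k h) x + moment p (k g) (x + X h)]
      (mod int p ^ 2)" (is ?moment)
    and "[(\<Sum>i<p. k (g \<otimes> h) (int i)) = tw g * (\<Sum>i<p. k h (int i)) + (\<Sum>i<p. k g (int i))]
      (mod int p ^ 2)" (is ?sum)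
proof -
  have "[moment p (k (g \<otimes> h)) x =
      (\<Sum>i<p. int i * (tw g * k h (int i + x) + k g (int i + x + X h)))] (mod int p ^ 2)"
    unfolding moment_def by (intro cong_sum cong_scalar_left k gh)
  also have "(\<Sum>i<p. int i * (tw g * k h (int i + x) + k g (int i + x + X h))) =
      tw g * moment p (k h) x + moment p (k g) (x + X h)"
    by (simp add: moment_def sum.distrib sum_distrib_left algebra_simps)
  finally show ?moment .
  have "[(\<Sum>i<p. k (g \<otimes> h) (int i)) = (\<Sum>i<p. tw g * k h (int i) + k g (int i + X h))]
      (mod int p ^ 2)"
    by (intro cong_sum k gh)
  also have "(\<Sum>i<p. tw g * k h (int i) + k g (int i + X h)) =
      tw g * (\<Sum>i<p. k h (int i)) + (\<Sum>i<p. k g (int i))"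
    using periodic_sum_shift[where k = "k g", OF per] by (simp add: sum.distrib sum_distrib_left)
  finally show ?sum .
qed

lemma lc_sum_carrier:
  assumes "\<And>u. lc (carrier G) (\<lambda>g. k g u)"
  shows "lc (carrier G) (\<lambda>g. \<Sum>i<p. a i * k g (u i))"
  by (intro locally_constant_on_sum openin_carrier finite_lessThan
      locally_constant_on_compose[where F = "\<lambda>y. b * y" for b] assms)

lemma twisted_cong:
  assumes "g \<in> carrier G" shows "[tw g * a + b = a + b] (mod int p)"
  using cong_add[OF cong_scalar_right[OF tw_cong_1[OF assms]] cong_refl, of a b] by simp

text \<open>Here \<open>C1\<close> and \<open>C3\<close> differ from \<open>c1\<close> and \<open>c3\<close> by homomorphisms: this is the freedom in the choice
  of a defining system.\<close>

lemma triple_massey_cochains: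
  assumes lcx1: "lc (carrier G) x1" and lcx2: "lc (carrier G) x2" and lcx3: "lc (carrier G) x3"
    and lcc1: "lc (carrier G) c1" and lcc3: "lc (carrier G) c3"
    and x1: "\<And>g h. g \<in> carrier G \<Longrightarrow> h \<in> carrier G \<Longrightarrow> [x1 (g \<otimes> h) = x1 g + x1 h] (mod int p)"
    and x2: "\<And>g h. g \<in> carrier G \<Longrightarrow> h \<in> carrier G \<Longrightarrow> [x2 (g \<otimes> h) = x2 g + x2 h] (mod int p)"
    and x3: "\<And>g h. g \<in> carrier G \<Longrightarrow> h \<in> carrier G \<Longrightarrow> [x3 (g \<otimes> h) = x3 g + x3 h] (mod int p)"
    and c1: "\<And>g h. g \<in> carrier G \<Longrightarrow> h \<in> carrier G \<Longrightarrow>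
      [c1 (g \<otimes> h) = c1 g + c1 h - x1 h * x2 g] (mod int p)"
    and c3: "\<And>g h. g \<in> carrier G \<Longrightarrow> h \<in> carrier G \<Longrightarrow>
      [c3 (g \<otimes> h) = c3 g + c3 h - x3 h * x2 g] (mod int p)"
  obtains C1 C3 D where
    "lc (carrier G) C1" "lc (carrier G) C3" "lc (carrier G) D"
    "\<And>g h. g \<in> carrier G \<Longrightarrow> h \<in> carrier G \<Longrightarrow>
      [C1 (g \<otimes> h) = C1 g + C1 h - x1 h * x2 g] (mod int p)"
    "\<And>g h. g \<in> carrier G \<Longrightarrow> h \<in> carrier G \<Longrightarrow>
      [C3 (g \<otimes> h) = C3 g + C3 h - x3 h * x2 g] (mod int p)"
    "\<And>g h. g \<in> carrier G \<Longrightarrow> h \<in> carrier G \<Longrightarrow>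
      [D (g \<otimes> h) = D g + D h - x3 h * C1 g - x1 h * C3 g + x2 g * x1 h * x3 h - x2 g * x1 h]
      (mod int p)"
proof -
  \<comment> \<open>A polarization: comparing the cocycle for \<open>x1 - x3\<close> with those for
    \<open>x1\<close> and \<open>x3\<close> cancels \<open>x1 h * c1 g\<close> and
    \<open>x3 h * c3 g\<close> and leaves the cross terms \<open>x3 h * c1 g\<close> and
    \<open>x1 h * c3 g\<close>.\<close>
  define xl where "xl = (\<lambda>g. x1 g - x3 g)"
  define cl where "cl = (\<lambda>g. c1 g - c3 g)"
  have xl: "[xl (g \<otimes> h) = xl g + xl h] (mod int p)" if "g \<in> carrier G" "h \<in> carrier G" for g h
    using cong_diff[OF x1[OF that] x3[OF that]] by (simp add: xl_def algebra_simps)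
  have cl: "[cl (g \<otimes> h) = cl g + cl h - xl h * x2 g] (mod int p)"
    if "g \<in> carrier G" "h \<in> carrier G" for g h
    using cong_diff[OF c1[OF that] c3[OF that]] by (simp add: xl_def cl_def algebra_simps)
  have lcxl: "lc (carrier G) xl" and lccl: "lc (carrier G) cl"
    unfolding xl_def cl_def
    by (intro locally_constant_on_compose2[where F = "(-)"] lcx1 lcx3 lcc1 lcc3)+
  obtain k1 where lck1: "\<And>u. lc (carrier G) (\<lambda>g. k1 g u)"
    and per1: "\<And>g u. k1 g (u mod int p) = k1 g u"
    and k1: "\<And>g h u. g \<in> carrier G \<Longrightarrow> h \<in> carrier G \<Longrightarrow>
      [k1 (g \<otimes> h) u = tw g * k1 h u + k1 g (u + x1 h)] (mod int p ^ 2)"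
    and mod1: "\<And>g u. g \<in> carrier G \<Longrightarrow> [k1 g u = c1 g - u * x2 g] (mod int p)"
    by (rule shapiro_lift[OF lcx1 x1 lcx2 x2 lcc1 c1]; blast)
  obtain k3 where lck3: "\<And>u. lc (carrier G) (\<lambda>g. k3 g u)"
    and per3: "\<And>g u. k3 g (u mod int p) = k3 g u"
    and k3: "\<And>g h u. g \<in> carrier G \<Longrightarrow> h \<in> carrier G \<Longrightarrow>
      [k3 (g \<otimes> h) u = tw g * k3 h u + k3 g (u + x3 h)] (mod int p ^ 2)"
    and mod3: "\<And>g u. g \<in> carrier G \<Longrightarrow> [k3 g u = c3 g - u * x2 g] (mod int p)"
    by (rule shapiro_lift[OF lcx3 x3 lcx2 x2 lcc3 c3]; blast)
  obtain kl where lckl: "\<And>u. lc (carrier G) (\<lambda>g. kl g u)"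
    and perl: "\<And>g u. kl g (u mod int p) = kl g u"
    and kl: "\<And>g h u. g \<in> carrier G \<Longrightarrow> h \<in> carrier G \<Longrightarrow>
      [kl (g \<otimes> h) u = tw g * kl h u + kl g (u + xl h)] (mod int p ^ 2)"
    and modl: "\<And>g u. g \<in> carrier G \<Longrightarrow> [kl g u = cl g - u * x2 g] (mod int p)"
    by (rule shapiro_lift[OF lcxl xl lcx2 x2 lccl cl]; blast)
  define S1 S3 Sl where S: "S1 = (\<lambda>g. \<Sum>i<p. k1 g (int i))" "S3 = (\<lambda>g. \<Sum>i<p. k3 g (int i))"
    "Sl = (\<lambda>g. \<Sum>i<p. kl g (int i))"
  \<comment> \<open>The offset 1 makes the binomial terms combine to \<open>x * y - x\<close>; the
    linear part contributes \<open>x2 g * x1 h\<close>, up to sign the coboundary of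
    \<open>C1\<close>.\<close>
  define A where "A = (\<lambda>g. moment p (kl g) 1 - moment p (k1 g) 0 - moment p (k3 g) 0)"
  have lcS: "lc (carrier G) S1" "lc (carrier G) S3" "lc (carrier G) Sl"
    using lc_sum_carrier[where a = "\<lambda>i. 1" and u = int] lck1 lck3 lckl unfolding S by simp_all
  have lcM: "lc (carrier G) (\<lambda>g. moment p (k g) x)" if "\<And>u. lc (carrier G) (\<lambda>g. k g u)" for k x
    unfolding moment_def using that by (rule lc_sum_carrier)
  have lcA: "lc (carrier G) A"
    unfolding A_def
    by (intro locally_constant_on_compose2[where F = "(-)"] lcM lck1 lck3 lckl)
  \<comment> \<open>Modulo \<open>p\<close> each of the three sums is \<open>- x2 g\<close> times
    the sum of the indices, and twice the latter is \<open>p * (p - 1)\<close>. Hence both quotients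
    are exact, also for \<open>p = 2\<close>, where a single sum may be odd.\<close>
  define e1 where "e1 = (\<lambda>g. (S1 g - Sl g) div int p)"
  define e3 where "e3 = (\<lambda>g. (S3 g + Sl g) div int p)"
  have S1_eq: "S1 g = Sl g + int p * e1 g" if "g \<in> carrier G" for g
  proof -
    have "[S1 g = Sl g] (mod int p)"
      using sum_affine_cong[OF mod1[OF that]] sum_affine_cong[OF modl[OF that]]
      unfolding S by (simp add: cong_def)
    then have "int p dvd S1 g - Sl g"
      by (simp add: cong_iff_dvd_diff)
    then show ?thesis
      by (simp add: e1_def)
  qed
  have S3_eq: "S3 g = int p * e3 g - Sl g" if "g \<in> carrier G" for g
  proof -
    let ?s = "- (x2 g * (\<Sum>i<p. int i))"
    have "[S3 g + Sl g = ?s + ?s] (mod int p)"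
      unfolding S using sum_affine_cong[OF mod3[OF that]] sum_affine_cong[OF modl[OF that]]
      by (rule cong_add)
    moreover have "?s + ?s = int p * (- x2 g * (int p - 1))"
      using arg_cong[OF double_sum_int[of p], of "\<lambda>z. x2 g * z"] by (simp add: algebra_simps)
    ultimately have "int p dvd S3 g + Sl g"
      by (metis cong_dvd_iff dvd_triv_left)
    then show ?thesis
      by (simp add: e3_def)
  qed
  note S_mult = moment_mult(2)[OF per1 k1] moment_mult(2)[OF per3 k3] moment_mult(2)[OF perl kl]
  have e1_mult: "[e1 (g \<otimes> h) = e1 g + e1 h] (mod int p)" if gh: "g \<in> carrier G" "h \<in> carrier G" for g h
  proof -
    have "[S1 (g \<otimes> h) - Sl (g \<otimes> h) = (tw g * S1 h + S1 g) - (tw g * Sl h + Sl g)] (mod int p ^ 2)"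
      unfolding S by (intro cong_diff S_mult gh)
    then have "[int p * e1 (g \<otimes> h) = int p * (tw g * e1 h + e1 g)] (mod int p ^ 2)"
      using gh by (simp add: S1_eq algebra_simps)
    from cong_mult_modulus_cancel[OF this p_pos] twisted_cong[OF gh(1)]
    show ?thesis
      by (metis add.commute cong_trans)
  qed
  have e3_mult: "[e3 (g \<otimes> h) = e3 g + e3 h] (mod int p)" if gh: "g \<in> carrier G" "h \<in> carrier G" for g h
  proof -
    have "[S3 (g \<otimes> h) + Sl (g \<otimes> h) = (tw g * S3 h + S3 g) + (tw g * Sl h + Sl g)] (mod int p ^ 2)"
      unfolding S by (intro cong_add S_mult gh)
    then have "[int p * e3 (g \<otimes> h) = int p * (tw g * e3 h + e3 g)] (mod int p ^ 2)"
      using gh by (simp add: S3_eq algebra_simps)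
    from cong_mult_modulus_cancel[OF this p_pos] twisted_cong[OF gh(1)]
    show ?thesis
      by (metis add.commute cong_trans)
  qed
  \<comment> \<open>The indices cross: in the defect of \<open>A\<close>, \<open>e3\<close> is
    multiplied by \<open>x3 h\<close>, as is \<open>c1\<close>, while \<open>e1\<close> is
    multiplied by \<open>x1 h\<close>, as is \<open>c3\<close>.\<close>
  define C1 where "C1 = (\<lambda>g. c1 g - e3 g)"
  define C3 where "C3 = (\<lambda>g. c3 g - e1 g)"
  define W where "W = (\<lambda>g h. x2 g * x1 h * x3 h - x2 g * x1 h - x3 h * C1 g - x1 h * C3 g)"
  have A_mult: "[A (g \<otimes> h) = tw g * A h + A g + int p * W g h] (mod int p ^ 2)"
    if gh: "g \<in> carrier G" "h \<in> carrier G" for g h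
  proof -
    define x y z where xyz: "x = x1 h" "y = x3 h" "z = 1 + xl h"
    define b where "b = (\<lambda>x :: int. x * (x - 1) div 2)"
    have z: "z = x - y + 1"
      by (simp add: xyz xl_def)
    have b2: "2 * b u = u * (u - 1)" for u
      by (simp add: b_def)
    have b_sum: "b x + b y - b z = x * y - x"
    proof -
      have "2 * (b x + b y - b z) = x * (x - 1) + y * (y - 1) - z * (z - 1)"
        unfolding distrib_left right_diff_distrib[of 2] b2 ..
      also have "\<dots> = 2 * (x * y - x)"
        by (simp add: z algebra_simps)
      finally show ?thesis
        by (rule iffD1[OF mult_left_cancel, rotated]) simp
    qed
    have step1: "[A (g \<otimes> h) = (tw g * moment p (kl h) 1 + moment p (kl g) z)
        - (tw g * moment p (k1 h) 0 + moment p (k1 g) x)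
        - (tw g * moment p (k3 h) 0 + moment p (k3 g) y)] (mod int p ^ 2)"
      unfolding A_def xyz
      using moment_mult(1)[OF perl kl gh, of 1] moment_mult(1)[OF per1 k1 gh, of 0]
        moment_mult(1)[OF per3 k3 gh, of 0]
      by (intro cong_diff) simp_all
    \<comment> \<open>\<open>moment_cong\<close> is based at 0, so its instances at \<open>z\<close>
      and at 1 are subtracted.\<close>
    have Ml: "[moment p (kl g) z = moment p (kl g) 1
        + (int p * ((z - 1) * cl g - b z * x2 g) - (z - 1) * Sl g)] (mod int p ^ 2)"
      using cong_diff[OF moment_cong[of "kl g" p "cl g" "x2 g" z]
          moment_cong[of "kl g" p "cl g" "x2 g" 1], OF perl modl[OF gh(1)] perl modl[OF gh(1)]]
      by (simp add: cong_iff_dvd_diff S b_def algebra_simps)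
    have M1: "[moment p (k1 g) x = moment p (k1 g) 0
        + int p * (x * c1 g - b x * x2 g) - x * S1 g] (mod int p ^ 2)"
      unfolding S b_def by (rule moment_cong[OF per1 mod1[OF gh(1)]])
    have M3: "[moment p (k3 g) y = moment p (k3 g) 0
        + int p * (y * c3 g - b y * x2 g) - y * S3 g] (mod int p ^ 2)"
      unfolding S b_def by (rule moment_cong[OF per3 mod3[OF gh(1)]])
    note step1
    also have "[(tw g * moment p (kl h) 1 + moment p (kl g) z)
        - (tw g * moment p (k1 h) 0 + moment p (k1 g) x)
        - (tw g * moment p (k3 h) 0 + moment p (k3 g) y) =
        (tw g * moment p (kl h) 1 + (moment p (kl g) 1
          + (int p * ((z - 1) * cl g - b z * x2 g) - (z - 1) * Sl g)))
        - (tw g * moment p (k1 h) 0 + (moment p (k1 g) 0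
          + int p * (x * c1 g - b x * x2 g) - x * S1 g))
        - (tw g * moment p (k3 h) 0 + (moment p (k3 g) 0
          + int p * (y * c3 g - b y * x2 g) - y * S3 g))] (mod int p ^ 2)"
      by (rule cong_diff[OF cong_diff])
        (intro cong_add cong_refl Ml M1 M3)+
    also have "(tw g * moment p (kl h) 1 + (moment p (kl g) 1
          + (int p * ((z - 1) * cl g - b z * x2 g) - (z - 1) * Sl g)))
        - (tw g * moment p (k1 h) 0 + (moment p (k1 g) 0
          + int p * (x * c1 g - b x * x2 g) - x * S1 g))
        - (tw g * moment p (k3 h) 0 + (moment p (k3 g) 0
          + int p * (y * c3 g - b y * x2 g) - y * S3 g)) =
        tw g * A h + A g + (int p * ((z - 1) * cl g - x * c1 g - y * c3 g + (b x + b y - b z) * x2 g)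
          + (x * S1 g + y * S3 g - (z - 1) * Sl g))"
      unfolding A_def by (simp add: algebra_simps)
    \<comment> \<open>As \<open>z - 1 = x - y\<close>, the plain sums regroup into
      \<open>x * (S1 g - Sl g) + y * (S3 g + Sl g)\<close>, a multiple of \<open>p\<close>.\<close>
    also have "int p * ((z - 1) * cl g - x * c1 g - y * c3 g + (b x + b y - b z) * x2 g)
          + (x * S1 g + y * S3 g - (z - 1) * Sl g) = int p * W g h"
      unfolding b_sum S1_eq[OF gh(1)] S3_eq[OF gh(1)]
      unfolding z cl_def W_def C1_def C3_def xyz(1,2)[symmetric]
      by (simp add: algebra_simps)
    finally show ?thesis .
  qed
  have A_hom: "[A (g \<otimes> h) = A g + A h] (mod int p)" if gh: "g \<in> carrier G" "h \<in> carrier G" for g h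
  proof -
    have "[A (g \<otimes> h) = tw g * A h + A g + int p * W g h] (mod int p)"
      using A_mult[OF gh] by (rule cong_dvd_modulus) (simp add: power2_eq_square)
    also have "[tw g * A h + A g + int p * W g h = A h + A g + 0] (mod int p)"
      by (intro cong_add[OF twisted_cong[OF gh(1)]]) (simp add: cong_def)
    finally show ?thesis
      by (simp add: add.commute)
  qed
  obtain F where lcF: "lc (carrier G) F"
    and F: "\<And>g h. g \<in> carrier G \<Longrightarrow> h \<in> carrier G \<Longrightarrow> [F (g \<otimes> h) = F g + tw g * F h] (mod int p ^ 2)"
    and FA: "\<And>g. g \<in> carrier G \<Longrightarrow> [F g = A g] (mod int p)"
    by (rule hom_lift[OF subgroup_self openin_carrier lcA A_hom]; blast)
  \<comment> \<open>\<open>F\<close> is a genuine twisted cocycle, so subtracting it makes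
    \<open>A\<close> divisible by \<open>p\<close> without changing its defect
    \<open>int p * W g h\<close>.\<close>
  define D where "D = (\<lambda>g. (A g - F g) div int p)"
  have A_eq: "A g - F g = int p * D g" if "g \<in> carrier G" for g
    using cong_sym[OF FA[OF that]] by (simp add: D_def cong_iff_dvd_diff)
  have D_mult: "[D (g \<otimes> h) = D g + D h + W g h] (mod int p)"
    if gh: "g \<in> carrier G" "h \<in> carrier G" for g h
  proof -
    have "[A (g \<otimes> h) - F (g \<otimes> h) = tw g * A h + A g + int p * W g h - (F g + tw g * F h)]
        (mod int p ^ 2)"
      by (intro cong_diff A_mult F gh)
    also have "tw g * A h + A g + int p * W g h - (F g + tw g * F h) =
        tw g * (A h - F h) + (A g - F g) + int p * W g h"
      by (simp add: algebra_simps)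
    finally have "[int p * D (g \<otimes> h) = int p * (tw g * D h + (D g + W g h))] (mod int p ^ 2)"
      using gh by (simp add: A_eq algebra_simps)
    from cong_trans[OF cong_mult_modulus_cancel[OF this p_pos] twisted_cong[OF gh(1)]]
    show ?thesis
      by (simp add: algebra_simps)
  qed
  show thesis
  proof (rule that[of C1 C3 D])
    have lce: "lc (carrier G) e1" "lc (carrier G) e3"
      unfolding e1_def e3_def
      by (intro locally_constant_on_compose2[where F = "\<lambda>a b. (a - b) div int p"]
          locally_constant_on_compose2[where F = "\<lambda>a b. (a + b) div int p"] lcS)+
    show "lc (carrier G) C1" "lc (carrier G) C3"
      unfolding C1_def C3_def
      by (intro locally_constant_on_compose2[where F = "(-)"] lcc1 lcc3 lce)+
    show "lc (carrier G) D"
      unfolding D_def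
      by (intro locally_constant_on_compose2[where F = "\<lambda>a b. (a - b) div int p"] lcA lcF)
    show "[C1 (g \<otimes> h) = C1 g + C1 h - x1 h * x2 g] (mod int p)"
      "[C3 (g \<otimes> h) = C3 g + C3 h - x3 h * x2 g] (mod int p)"
      if gh: "g \<in> carrier G" "h \<in> carrier G" for g h
      using cong_diff[OF c1[OF gh] e3_mult[OF gh]] cong_diff[OF c3[OF gh] e1_mult[OF gh]]
      by (simp_all add: C1_def C3_def algebra_simps)
    show "[D (g \<otimes> h) = D g + D h - x3 h * C1 g - x1 h * C3 g + x2 g * x1 h * x3 h - x2 g * x1 h]
        (mod int p)" if "g \<in> carrier G" "h \<in> carrier G" for g h
      using D_mult[OF that] by (simp add: W_def algebra_simps)
  qed
qed

section \<open>Defining systems and values modulo \<open>p\<close>\<close>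

lemma d1_mod: "d1 p G (\<lambda>g. f g mod int p) g h = (f h - f (g \<otimes> h) + f g) mod int p"
proof -
  have "[f h mod int p - f (g \<otimes> h) mod int p + f g mod int p
      = f h - f (g \<otimes> h) + f g] (mod int p)"
    by (intro cong_add cong_diff) simp_all
  then show ?thesis
    by (simp add: d1_def cong_def)
qed

lemma cochain1_mod:
  assumes "lc (carrier G) f"
  shows "cochain1 p G T (\<lambda>g. f g mod int p)"
  using locally_constant_on_compose[OF assms, of "\<lambda>x. x mod int p"] p_pos
  by (simp add: cochain1_def cochain1_on_def continuous_map_subtopology_disc_iff[OF openin_carrier])

lemma cochain1_lc: "cochain1 p G T f \<Longrightarrow> lc (carrier G) f"
  by (simp add: cochain1_def cochain1_on_def continuous_map_subtopology_disc_iff[OF openin_carrier])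

lemma cocycle1_hom:
  assumes "cocycle1 p G T f" "g \<in> carrier G" "h \<in> carrier G"
  shows "[f (g \<otimes> h) = f g + f h] (mod int p)"
proof -
  have "int p dvd f h - f (g \<otimes> h) + f g"
    using assms by (auto simp: cocycle1_def d1_def)
  then have "int p dvd - (f h - f (g \<otimes> h) + f g)"
    by (simp only: dvd_minus_iff)
  then show ?thesis
    by (simp add: cong_iff_dvd_diff algebra_simps)
qed

lemma massey3_vanishes_of_cup_zero:
  assumes x: "cocycle1 p G T x1" "cocycle1 p G T x2" "cocycle1 p G T x3"
    and cup: "h2_zero p G T (cup11 p x1 x2)" "h2_zero p G T (cup11 p x2 x3)"
  shows "massey3_vanishes p G T x1 x2 x3"
proof -
  have lcx: "lc (carrier G) x1" "lc (carrier G) x2" "lc (carrier G) x3"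
    using x by (auto simp: cocycle1_def intro: cochain1_lc)
  note homs = x[THEN cocycle1_hom]
  obtain b1 where b1: "cochain1 p G T b1"
    "\<And>g h. g \<in> carrier G \<Longrightarrow> h \<in> carrier G \<Longrightarrow> [x1 g * x2 h = b1 h - b1 (g \<otimes> h) + b1 g] (mod int p)"
    using cup(1) by (auto simp: h2_zero_def cup11_def d1_def cong_def)
  obtain b3 where b3: "cochain1 p G T b3"
    "\<And>g h. g \<in> carrier G \<Longrightarrow> h \<in> carrier G \<Longrightarrow> [x2 g * x3 h = b3 h - b3 (g \<otimes> h) + b3 g] (mod int p)"
    using cup(2) by (auto simp: h2_zero_def cup11_def d1_def cong_def)
  \<comment> \<open>Graded commutativity of the cup product: the coboundary of
    \<open>x1 * x2\<close> is \<open>- (x1 g * x2 h + x1 h * x2 g)\<close>, so subtracting it brings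
    \<open>x2\<close> into the first place, the form used in the Shapiro lift.\<close>
  define c1 where "c1 = (\<lambda>g. - b1 g - x1 g * x2 g)"
  have c1: "[c1 (g \<otimes> h) = c1 g + c1 h - x1 h * x2 g] (mod int p)"
    if gh: "g \<in> carrier G" "h \<in> carrier G" for g h
  proof -
    have "[c1 (g \<otimes> h) = x1 g * x2 h - b1 h - b1 g - (x1 g + x1 h) * (x2 g + x2 h)] (mod int p)"
      unfolding c1_def
    proof (rule cong_diff[OF cong_sym cong_mult[OF homs(1)[OF gh] homs(2)[OF gh]]])
      show "[x1 g * x2 h - b1 h - b1 g = - b1 (g \<otimes> h)] (mod int p)"
        using b1(2)[OF gh] by (simp add: cong_iff_dvd_diff algebra_simps)
    qed
    also have "x1 g * x2 h - b1 h - b1 g - (x1 g + x1 h) * (x2 g + x2 h) =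
        c1 g + c1 h - x1 h * x2 g"
      by (simp add: c1_def algebra_simps)
    finally show ?thesis .
  qed
  have b3': "[b3 (g \<otimes> h) = b3 g + b3 h - x3 h * x2 g] (mod int p)"
    if gh: "g \<in> carrier G" "h \<in> carrier G" for g h
    using b3(2)[OF gh] by (simp add: cong_iff_dvd_diff algebra_simps dvd_diff_commute)
  have lc_c1: "lc (carrier G) c1"
    unfolding c1_def
    by (intro locally_constant_on_compose2[where F = "(-)"] locally_constant_on_compose2[where F = "(*)"]
        locally_constant_on_compose[where F = uminus] lcx cochain1_lc b1)
  obtain C1 C3 D where lcs: "lc (carrier G) C1" "lc (carrier G) C3" "lc (carrier G) D"
    and C1: "\<And>g h. g \<in> carrier G \<Longrightarrow> h \<in> carrier G \<Longrightarrow>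
      [C1 (g \<otimes> h) = C1 g + C1 h - x1 h * x2 g] (mod int p)"
    and C3: "\<And>g h. g \<in> carrier G \<Longrightarrow> h \<in> carrier G \<Longrightarrow>
      [C3 (g \<otimes> h) = C3 g + C3 h - x3 h * x2 g] (mod int p)"
    and D: "\<And>g h. g \<in> carrier G \<Longrightarrow> h \<in> carrier G \<Longrightarrow>
      [D (g \<otimes> h) = D g + D h - x3 h * C1 g - x1 h * C3 g + x2 g * x1 h * x3 h - x2 g * x1 h]
      (mod int p)"
    by (rule triple_massey_cochains[OF lcx lc_c1 cochain1_lc[OF b3(1)] homs c1 b3']; blast)
  \<comment> \<open>Adding \<open>x1 * x2\<close> undoes the interchange of factors made for
    \<open>c1\<close>. The signs are those for which the coboundaries are the negatives of the cup
    products.\<close>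
  define a13 where "a13 = (\<lambda>g. (C1 g + x1 g * x2 g) mod int p)"
  define a24 where "a24 = (\<lambda>g. (- C3 g) mod int p)"
  \<comment> \<open>The coboundary of \<open>C1\<close> removes \<open>x2 g * x1 h\<close> from that
    of \<open>D\<close>, and the product \<open>x1 * C3\<close> turns the term
    \<open>x1 h * C3 g\<close> into \<open>x1 g * C3 h\<close>.\<close>
  define b where "b = (\<lambda>g. (C1 g - D g - x1 g * C3 g) mod int p)"
  have "cochain1 p G T a13" "cochain1 p G T a24" and coch_b: "cochain1 p G T b"
    unfolding a13_def a24_def b_def
    by (intro cochain1_mod locally_constant_on_compose2[where F = "(-)"]
        locally_constant_on_compose2[where F = "(+)"] locally_constant_on_compose2[where F = "(*)"]
        locally_constant_on_compose[where F = uminus] lcx lcs)+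
  moreover have "d1 p G a13 g h = (- cup11 p x1 x2 g h) mod int p"
    if gh: "g \<in> carrier G" "h \<in> carrier G" for g h
  proof -
    have "[(C1 h + x1 h * x2 h) - (C1 (g \<otimes> h) + x1 (g \<otimes> h) * x2 (g \<otimes> h)) + (C1 g + x1 g * x2 g) =
      (C1 h + x1 h * x2 h) - ((C1 g + C1 h - x1 h * x2 g) + (x1 g + x1 h) * (x2 g + x2 h))
      + (C1 g + x1 g * x2 g)] (mod int p)"
      by (intro cong_add cong_diff cong_mult cong_refl C1 homs gh)
    also have "(C1 h + x1 h * x2 h) - ((C1 g + C1 h - x1 h * x2 g) + (x1 g + x1 h) * (x2 g + x2 h))
      + (C1 g + x1 g * x2 g) = - (x1 g * x2 h)"
      by (simp add: algebra_simps)
    finally show ?thesis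
      unfolding a13_def d1_mod cup11_def cong_def by (simp add: mod_simps)
  qed
  moreover have "d1 p G a24 g h = (- cup11 p x2 x3 g h) mod int p"
    if gh: "g \<in> carrier G" "h \<in> carrier G" for g h
  proof -
    have "[- C3 h - (- C3 (g \<otimes> h)) + - C3 g = - C3 h - (- (C3 g + C3 h - x3 h * x2 g)) + - C3 g] (mod int p)"
      by (intro cong_add cong_diff cong_refl cong_minus_minus_iff[THEN iffD2] C3 gh)
    also have "- C3 h - (- (C3 g + C3 h - x3 h * x2 g)) + - C3 g = - (x2 g * x3 h)"
      by (simp add: algebra_simps)
    finally show ?thesis
      unfolding a24_def d1_mod cup11_def cong_def by (simp add: mod_simps)
  qed
  ultimately have "massey3_defining_system p G T x1 x2 x3 x1 x2 x3 a13 a24"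
    using x by (simp add: massey3_defining_system_def cocycle1_def)
  moreover have "massey3_value p x1 x3 a13 a24 g h = d1 p G b g h"
    if gh: "g \<in> carrier G" "h \<in> carrier G" for g h
  proof -
    have "[(C1 h - D h - x1 h * C3 h) - (C1 (g \<otimes> h) - D (g \<otimes> h) - x1 (g \<otimes> h) * C3 (g \<otimes> h))
        + (C1 g - D g - x1 g * C3 g) =
      (C1 h - D h - x1 h * C3 h) - ((C1 g + C1 h - x1 h * x2 g)
          - (D g + D h - x3 h * C1 g - x1 h * C3 g + x2 g * x1 h * x3 h - x2 g * x1 h)
          - (x1 g + x1 h) * (C3 g + C3 h - x3 h * x2 g))
        + (C1 g - D g - x1 g * C3 g)] (mod int p)"
      by (intro cong_add[OF cong_diff[OF cong_refl cong_diff[OF cong_diff]] cong_refl]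
          cong_mult C1 C3 D homs gh)
    also have "(C1 h - D h - x1 h * C3 h) - ((C1 g + C1 h - x1 h * x2 g)
          - (D g + D h - x3 h * C1 g - x1 h * C3 g + x2 g * x1 h * x3 h - x2 g * x1 h)
          - (x1 g + x1 h) * (C3 g + C3 h - x3 h * x2 g))
        + (C1 g - D g - x1 g * C3 g) =
      - (x1 g * - C3 h + (C1 g + x1 g * x2 g) * x3 h)"
      by (simp add: algebra_simps)
    finally have "(- (x1 g * - C3 h + (C1 g + x1 g * x2 g) * x3 h)) mod int p = d1 p G b g h"
      unfolding b_def d1_mod cong_def by simp
    moreover have "[- ((x1 g * (- C3 h mod int p)) mod int p
          + ((C1 g + x1 g * x2 g) mod int p * x3 h) mod int p) =
        - (x1 g * - C3 h + (C1 g + x1 g * x2 g) * x3 h)] (mod int p)"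
      by (intro cong_minus_minus_iff[THEN iffD2] cong_add)
        (simp_all only: cong_def mod_mod_trivial mod_mult_left_eq mod_mult_right_eq)
    ultimately show ?thesis
      unfolding massey3_value_def a13_def a24_def cup11_def cong_def by simp
  qed
  ultimately show ?thesis
    unfolding massey3_vanishes_def h2_zero_def using coch_b by blast
qed

text \<open>The entries \<open>a13\<close> and \<open>a24\<close> of a defining system bound the cup
  products up to sign, so their negatives are the primitives sought.\<close>

lemma cup_zero_of_massey3_defined:
  assumes "massey3_defined p G T x1 x2 x3"
  shows "h2_zero p G T (cup11 p x1 x2)" "h2_zero p G T (cup11 p x2 x3)"
proof -
  obtain a12 a23 a34 a13 a24
    where "massey3_defining_system p G T x1 x2 x3 a12 a23 a34 a13 a24"
    using assms by (auto simp: massey3_defined_def)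
  then have a: "cochain1 p G T a13" "cochain1 p G T a24"
    "\<And>g h. g \<in> carrier G \<Longrightarrow> h \<in> carrier G \<Longrightarrow> d1 p G a13 g h = (- cup11 p x1 x2 g h) mod int p"
    "\<And>g h. g \<in> carrier G \<Longrightarrow> h \<in> carrier G \<Longrightarrow> d1 p G a24 g h = (- cup11 p x2 x3 g h) mod int p"
    unfolding massey3_defining_system_def cup11_def by auto
  have zero: "h2_zero p G T (cup11 p u v)"
    if a: "cochain1 p G T a"
      and d: "\<And>g h. g \<in> carrier G \<Longrightarrow> h \<in> carrier G \<Longrightarrow> d1 p G a g h = (- cup11 p u v g h) mod int p"
    for a u v
    unfolding h2_zero_def
  proof (intro exI conjI ballI)
    show "cochain1 p G T (\<lambda>g. (- a g) mod int p)"
      by (intro cochain1_mod locally_constant_on_compose[where F = uminus] cochain1_lc a)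
    fix g h assume gh: "g \<in> carrier G" "h \<in> carrier G"
    have "[- (a h - a (g \<otimes> h) + a g) = - (- cup11 p u v g h)] (mod int p)"
      using d[OF gh] by (intro cong_minus_minus_iff[THEN iffD2]) (simp add: d1_def cong_def)
    then show "cup11 p u v g h = d1 p G (\<lambda>g. (- a g) mod int p) g h"
      unfolding d1_mod cup11_def cong_def by (simp add: algebra_simps)
  qed
  show "h2_zero p G T (cup11 p x1 x2)" "h2_zero p G T (cup11 p x2 x3)"
    using zero[OF a(1,3)] zero[OF a(2,4)] by auto
qed

end

theorem theorem1p3:
  fixes p :: nat and G :: "('a, 'b) monoid_scheme" and T :: "'a topology"
    and \<theta> :: "'a \<Rightarrow> nat \<Rightarrow> int" and x1 x2 x3 :: "'a \<Rightarrow> int"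
  assumes "prime p"
    and "profinite_group G T"
    and "p_orientation p G T \<theta>"
    and "formal_hilbert90 p G T \<theta>"
    and "cocycle1 p G T x1" and "cocycle1 p G T x2" and "cocycle1 p G T x3"
  shows "((h2_zero p G T (cup11 p x1 x2) \<and> h2_zero p G T (cup11 p x2 x3))
            \<longleftrightarrow> massey3_defined p G T x1 x2 x3)
       \<and> (massey3_defined p G T x1 x2 x3 \<longleftrightarrow> massey3_vanishes p G T x1 x2 x3)"
proof -
  interpret group G
    using assms(2) by (simp add: profinite_group_def)
  interpret oriented_group G p T \<theta>
    by standard (fact assms)+
  have "massey3_defined p G T x1 x2 x3" if "massey3_vanishes p G T x1 x2 x3"
    using that unfolding massey3_vanishes_def massey3_defined_def by blast
  then show ?thesis
    using massey3_vanishes_of_cup_zero[OF assms(5-7)] cup_zero_of_massey3_defined by blast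
qed

end
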